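(* Let $\{X(t),t>0\}$ be a zero-mean Gaussian process, real-valued or complex-valued circularly symmetric, with scale invariant ambiguity function $A_X$ and scale invariant Wigner spectrum $W_{E,X}$. For each $(t,\xi)\in\mathbb{R}^+\times\mathbb{R}$ and each kernel $\phi^{(t,\xi)}\in L^2(\mathbb{R}\times\mathbb{R}^+)$ (allowed to depend on $(t,\xi)$) put $$P_X(t,\xi)=\int_{-\infty}^\infty\int_0^\infty A_X(\theta,\tau)\,\phi^{(t,\xi)}(\theta,\tau)\,t^{i2\pi\theta}\,\tau^{-i2\pi\xi-1}\,d\tau\,d\theta,\qquad J(\phi^{(t,\xi)})=E\big\{|P_X(t,\xi)-W_{E,X}(t,\xi)|^2\big\}.$$ Then $P_X(t,\xi)$ achieves the minimum mean-square error if and only if $$E\big\{[P_X(t,\xi)-W_{E,X}(t,\xi)]\,A_X^*(\theta',\tau')\big\}=0\quad\text{for all }(\theta',\tau').$$ Equivalently, the locally optimal kernel $\phi_{opt}^{(t,\xi)}$, i.e. the kernel minimizing $J$ at $(t,\xi)$, is characterized by the linear equation $$\int_{-\infty}^\infty\int_0^\infty E\big\{A_X(\theta,\tau)A_X^*(\theta',\tau')\big\}\,\phi_{opt}^{(t,\xi)}(\theta,\tau)\,t^{i2\pi\theta}\,\tau^{-i2\pi\xi-1}\,d\tau\,d\theta=W_{E,X}(t,\xi)\,E\big\{A_X^*(\theta',\tau')\big\}\quad\text{for all }(\theta',\tau').$$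
   Context: $^*$ denotes complex conjugation and $\mathbb{R}^+=(0,\infty)$. Circularly symmetric means that the processes $\{e^{i\alpha}X(t)\}$ are identically distributed for all $\alpha\in[0,2\pi)$. Scale invariant ambiguity function: $A_X(\theta,\tau)=\int_0^\infty X(t\sqrt{\tau})\,X^*(t/\sqrt{\tau})\,t^{-i2\pi\theta-1}\,dt$. Scale invariant Wigner spectrum: $W_{E,X}(t,\xi)=\int_0^\infty R_X(t\sqrt{\tau},t/\sqrt{\tau})\,\tau^{-i2\pi\xi-1}\,d\tau$ with $R_X(t,s)=E(X(t)X^*(s))$. The stochastic integrals defining $A_X$ and $P_X$ are mean-square integrals, taken to exist for all argument values and to be second-order processes. For each $(t,\xi)$, the random variables $P_X(t,\xi)$, $\phi\in L^2(\mathbb{R}\times\mathbb{R}^+)$, form a subspace $S_X$ of a Hilbert space of second-order random variables, and the minimum mean-square error problem is that of the orthogonal projection of $W_{E,X}(t,\xi)$ onto the closure of $S_X$.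
   Formalization: X is additionally assumed jointly measurable in time and chance, and mean-square integrals are Bochner integrals; without this, adding independent Gaussian noise at each t changes A_X only at τ=1, and the condition "for all (θ',τ')" fails for the optimal kernel. *)

theory Defs
  imports "HOL-Probability.Probability"
begin

section \<open>Square integrability and mean-square integrals\<close>

text \<open>Used both for second-order random variables and for kernels in $L^2$.\<close>

definition square_integrable :: "'a measure \<Rightarrow> ('a \<Rightarrow> complex) \<Rightarrow> bool" where
  "square_integrable M f \<longleftrightarrow>
     f \<in> borel_measurable M \<and> integrable M (\<lambda>x. (cmod (f x))\<^sup>2)"

definition ms_norm :: "'a measure \<Rightarrow> ('a \<Rightarrow> complex) \<Rightarrow> real" where
  "ms_norm M Y = sqrt (\<integral>\<omega>. (cmod (Y \<omega>))\<^sup>2 \<partial>M)"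

text \<open>A list of pairs $(B, Z)$ represents the step function
  $u \mapsto \sum 1_B(u) Z$ with values in the random variables.\<close>

definition step_data :: "'a measure \<Rightarrow> 'u measure \<Rightarrow> ('u set \<times> ('a \<Rightarrow> complex)) list \<Rightarrow> bool" where
  "step_data M N s \<longleftrightarrow>
     (\<forall>(B, Z) \<in> set s. B \<in> sets N \<and> emeasure N B < \<infinity> \<and> square_integrable M Z)"

definition step_val :: "('u set \<times> ('a \<Rightarrow> complex)) list \<Rightarrow> 'u \<Rightarrow> 'a \<Rightarrow> complex" where
  "step_val s u \<omega> = (\<Sum>(B, Z)\<leftarrow>s. indicator B u * Z \<omega>)"

definition step_int :: "'u measure \<Rightarrow> ('u set \<times> ('a \<Rightarrow> complex)) list \<Rightarrow> 'a \<Rightarrow> complex" where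
  "step_int N s \<omega> = (\<Sum>(B, Z)\<leftarrow>s. of_real (measure N B) * Z \<omega>)"

text \<open>\<open>Y\<close> is the mean-square integral of the second-order process \<open>f\<close>: the Bochner integral
  in the Hilbert space of second-order random variables over \<open>M\<close>. It is the mean-square limit
  of the integrals of step functions that approximate \<open>f\<close>. The measurability clause is needed
  because the Lebesgue integral of a non-measurable function is only a lower integral.\<close>

definition has_ms_integral ::
    "'a measure \<Rightarrow> 'u measure \<Rightarrow> ('u \<Rightarrow> 'a \<Rightarrow> complex) \<Rightarrow> ('a \<Rightarrow> complex) \<Rightarrow> bool" where
  "has_ms_integral M N f Y \<longleftrightarrow>
     (\<forall>u \<in> space N. square_integrable M (f u)) \<and> square_integrable M Y \<and>
     (\<exists>s. (\<forall>n::nat. step_data M N (s n)) \<and>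
          (\<forall>n. (\<lambda>u. ms_norm M (\<lambda>\<omega>. f u \<omega> - step_val (s n) u \<omega>)) \<in> borel_measurable N) \<and>
          (\<lambda>n. \<integral>\<^sup>+u. ennreal (ms_norm M (\<lambda>\<omega>. f u \<omega> - step_val (s n) u \<omega>)) \<partial>N) \<longlonglongrightarrow> 0 \<and>
          (\<lambda>n. ms_norm M (\<lambda>\<omega>. Y \<omega> - step_int N (s n) \<omega>)) \<longlonglongrightarrow> 0)"

definition ms_integrable :: "'a measure \<Rightarrow> 'u measure \<Rightarrow> ('u \<Rightarrow> 'a \<Rightarrow> complex) \<Rightarrow> bool" where
  "ms_integrable M N f \<longleftrightarrow> (\<exists>Y. has_ms_integral M N f Y)"

text \<open>The mean-square integral is unique up to almost sure equality.\<close>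

definition ms_integral :: "'a measure \<Rightarrow> 'u measure \<Rightarrow> ('u \<Rightarrow> 'a \<Rightarrow> complex) \<Rightarrow> 'a \<Rightarrow> complex" where
  "ms_integral M N f = (SOME Y. has_ms_integral M N f Y)"


section \<open>Gaussian processes on the positive half-line\<close>

text \<open>Degenerate Gaussian variables (almost surely constant ones) are included.\<close>

definition gaussian_rv :: "'a measure \<Rightarrow> ('a \<Rightarrow> real) \<Rightarrow> bool" where
  "gaussian_rv M Y \<longleftrightarrow> Y \<in> borel_measurable M \<and>
     (\<exists>\<mu>. (AE \<omega> in M. Y \<omega> = \<mu>) \<or>
          (\<exists>\<sigma>>0. distributed M lborel Y (normal_density \<mu> \<sigma>)))"

text \<open>All real and imaginary parts are jointly Gaussian.\<close>

definition gaussian_process :: "'a measure \<Rightarrow> (real \<Rightarrow> 'a \<Rightarrow> complex) \<Rightarrow> bool" where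
  "gaussian_process M X \<longleftrightarrow>
     (\<forall>F a b. finite F \<and> F \<subseteq> {0<..} \<longrightarrow>
        gaussian_rv M (\<lambda>\<omega>. \<Sum>t\<in>F. a t * Re (X t \<omega>) + b t * Im (X t \<omega>)))"

definition measurable_process :: "'a measure \<Rightarrow> (real \<Rightarrow> 'a \<Rightarrow> complex) \<Rightarrow> bool" where
  "measurable_process M X \<longleftrightarrow>
     (\<lambda>(t, \<omega>). X t \<omega>) \<in> borel_measurable (restrict_space borel {0<..} \<Otimes>\<^sub>M M)"

definition zero_mean :: "'a measure \<Rightarrow> (real \<Rightarrow> 'a \<Rightarrow> complex) \<Rightarrow> bool" where
  "zero_mean M X \<longleftrightarrow> (\<forall>t>0. integrable M (X t) \<and> (\<integral>\<omega>. X t \<omega> \<partial>M) = 0)"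

definition real_valued :: "'a measure \<Rightarrow> (real \<Rightarrow> 'a \<Rightarrow> complex) \<Rightarrow> bool" where
  "real_valued M X \<longleftrightarrow> (\<forall>t>0. \<forall>\<omega>\<in>space M. X t \<omega> \<in> \<real>)"

definition process_law :: "'a measure \<Rightarrow> (real \<Rightarrow> 'a \<Rightarrow> complex) \<Rightarrow> (real \<Rightarrow> complex) measure" where
  "process_law M X = distr M (Pi\<^sub>M {0<..} (\<lambda>_. borel)) (\<lambda>\<omega>. \<lambda>t\<in>{0<..}. X t \<omega>)"

definition circularly_symmetric :: "'a measure \<Rightarrow> (real \<Rightarrow> 'a \<Rightarrow> complex) \<Rightarrow> bool" where
  "circularly_symmetric M X \<longleftrightarrow>
     (\<forall>\<alpha>\<in>{0..<2*pi}. process_law M (\<lambda>t \<omega>. exp (\<i> * of_real \<alpha>) * X t \<omega>) = process_law M X)"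


section \<open>Scale invariant time-frequency functions\<close>

definition ambiguity_integrand ::
    "(real \<Rightarrow> 'a \<Rightarrow> complex) \<Rightarrow> real \<Rightarrow> real \<Rightarrow> real \<Rightarrow> 'a \<Rightarrow> complex" where
  "ambiguity_integrand X \<theta> \<tau> t \<omega> =
     X (t * sqrt \<tau>) \<omega> * cnj (X (t / sqrt \<tau>) \<omega>) * of_real t powr (- (\<i> * 2 * of_real pi * of_real \<theta>) - 1)"

definition ambiguity ::
    "'a measure \<Rightarrow> (real \<Rightarrow> 'a \<Rightarrow> complex) \<Rightarrow> real \<Rightarrow> real \<Rightarrow> 'a \<Rightarrow> complex" where
  "ambiguity M X \<theta> \<tau> = ms_integral M (lebesgue_on {0<..}) (ambiguity_integrand X \<theta> \<tau>)"

definition covariance ::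
    "'a measure \<Rightarrow> (real \<Rightarrow> 'a \<Rightarrow> complex) \<Rightarrow> real \<Rightarrow> real \<Rightarrow> complex" where
  "covariance M X t s = (\<integral>\<omega>. X t \<omega> * cnj (X s \<omega>) \<partial>M)"

definition wigner_integrand ::
    "'a measure \<Rightarrow> (real \<Rightarrow> 'a \<Rightarrow> complex) \<Rightarrow> real \<Rightarrow> real \<Rightarrow> real \<Rightarrow> complex" where
  "wigner_integrand M X t \<xi> \<tau> =
     covariance M X (t * sqrt \<tau>) (t / sqrt \<tau>) * of_real \<tau> powr (- (\<i> * 2 * of_real pi * of_real \<xi>) - 1)"

definition wigner_spectrum ::
    "'a measure \<Rightarrow> (real \<Rightarrow> 'a \<Rightarrow> complex) \<Rightarrow> real \<Rightarrow> real \<Rightarrow> complex" where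
  "wigner_spectrum M X t \<xi> = (\<integral>\<tau>. wigner_integrand M X t \<xi> \<tau> \<partial>lebesgue_on {0<..})"

text \<open>The domain of the pairs $(\theta, \tau)$.\<close>

abbreviation half_plane :: "(real \<times> real) measure" where
  "half_plane \<equiv> lebesgue_on (UNIV \<times> {0<..})"

definition phase :: "real \<Rightarrow> real \<Rightarrow> real \<Rightarrow> real \<Rightarrow> complex" where
  "phase t \<xi> \<theta> \<tau> =
     of_real t powr (\<i> * 2 * of_real pi * of_real \<theta>) *
     of_real \<tau> powr (- (\<i> * 2 * of_real pi * of_real \<xi>) - 1)"

definition estimator_integrand ::
    "'a measure \<Rightarrow> (real \<Rightarrow> 'a \<Rightarrow> complex) \<Rightarrow> (real \<times> real \<Rightarrow> complex) \<Rightarrow> real \<Rightarrow> real \<Rightarrow>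
     real \<times> real \<Rightarrow> 'a \<Rightarrow> complex" where
  "estimator_integrand M X \<phi> t \<xi> = (\<lambda>(\<theta>, \<tau>) \<omega>. ambiguity M X \<theta> \<tau> \<omega> * \<phi> (\<theta>, \<tau>) * phase t \<xi> \<theta> \<tau>)"

definition estimator ::
    "'a measure \<Rightarrow> (real \<Rightarrow> 'a \<Rightarrow> complex) \<Rightarrow> (real \<times> real \<Rightarrow> complex) \<Rightarrow> real \<Rightarrow> real \<Rightarrow>
     'a \<Rightarrow> complex" where
  "estimator M X \<phi> t \<xi> = ms_integral M half_plane (estimator_integrand M X \<phi> t \<xi>)"


section \<open>Minimum mean-square error\<close>

definition ms_error :: "'a measure \<Rightarrow> complex \<Rightarrow> ('a \<Rightarrow> complex) \<Rightarrow> real" where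
  "ms_error M w Y = (\<integral>\<omega>. (cmod (Y \<omega> - w))\<^sup>2 \<partial>M)"

definition ms_closure :: "'a measure \<Rightarrow> ('a \<Rightarrow> complex) set \<Rightarrow> ('a \<Rightarrow> complex) set" where
  "ms_closure M S =
     {Y. square_integrable M Y \<and> (\<forall>\<epsilon>>0. \<exists>Z\<in>S. ms_norm M (\<lambda>\<omega>. Y \<omega> - Z \<omega>) < \<epsilon>)}"

definition estimator_space ::
    "'a measure \<Rightarrow> (real \<Rightarrow> 'a \<Rightarrow> complex) \<Rightarrow> real \<Rightarrow> real \<Rightarrow> ('a \<Rightarrow> complex) set" where
  "estimator_space M X t \<xi> = {estimator M X \<phi> t \<xi> |\<phi>. square_integrable half_plane \<phi>}"

text \<open>\<open>Y\<close> is a point of the closure of the estimator space nearest to the (deterministic)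
  Wigner spectrum, that is, its orthogonal projection onto that closure.\<close>

definition achieves_mmse ::
    "'a measure \<Rightarrow> (real \<Rightarrow> 'a \<Rightarrow> complex) \<Rightarrow> real \<Rightarrow> real \<Rightarrow> ('a \<Rightarrow> complex) \<Rightarrow> bool" where
  "achieves_mmse M X t \<xi> Y \<longleftrightarrow>
     Y \<in> ms_closure M (estimator_space M X t \<xi>) \<and>
     (\<forall>Z \<in> ms_closure M (estimator_space M X t \<xi>).
        ms_error M (wigner_spectrum M X t \<xi>) Y \<le> ms_error M (wigner_spectrum M X t \<xi>) Z)"

definition kernel_error ::
    "'a measure \<Rightarrow> (real \<Rightarrow> 'a \<Rightarrow> complex) \<Rightarrow> real \<Rightarrow> real \<Rightarrow> (real \<times> real \<Rightarrow> complex) \<Rightarrow> real" where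
  "kernel_error M X t \<xi> \<phi> = ms_error M (wigner_spectrum M X t \<xi>) (estimator M X \<phi> t \<xi>)"

definition locally_optimal ::
    "'a measure \<Rightarrow> (real \<Rightarrow> 'a \<Rightarrow> complex) \<Rightarrow> real \<Rightarrow> real \<Rightarrow> (real \<times> real \<Rightarrow> complex) \<Rightarrow> bool" where
  "locally_optimal M X t \<xi> \<phi> \<longleftrightarrow> square_integrable half_plane \<phi> \<and>
     (\<forall>\<psi>. square_integrable half_plane \<psi> \<longrightarrow> kernel_error M X t \<xi> \<phi> \<le> kernel_error M X t \<xi> \<psi>)"

end

theory Submission
  imports Defs
begin

text \<open>A mean-square integral \<open>Y\<close> of \<open>f\<close> satisfies \<open>E[Y e\<^sup>*] = \<integral> E[f(u) e\<^sup>*] du\<close> for every second-order \<open>e\<close>,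
  so with \<open>e = P - W\<close> the theorem is the projection theorem, once it is known that \<open>e\<close> is orthogonal
  to all estimators only if it is orthogonal to \<open>A(\<theta>, \<tau>)\<close> for all, and not just for almost all,
  \<open>(\<theta>, \<tau>)\<close>. Here \<open>h(\<theta>, \<tau>) = E[A(\<theta>, \<tau>) e\<^sup>*]\<close> is, for fixed \<open>\<tau>\<close>, the Mellin transform of
  \<open>G(t\<surd>\<tau>, t/\<surd>\<tau>)\<close>, where \<open>G(a, b) = E[X(a) X\<^sup>*(b) e\<^sup>*]\<close>. If \<open>h = 0\<close> almost everywhere, then
  by continuity in \<open>\<theta>\<close> and uniqueness of the transform \<open>G = 0\<close> for almost all \<open>(a, b)\<close>.
  Since \<open>X\<close> is jointly measurable and \<open>X(t)\<close> has finite fourth moments (it suffices to look at the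
  integrand of \<open>A(0, 1)\<close>), its range in \<open>L\<^sup>4\<close> is separable; hence \<open>G(a, b) = 0\<close> for all \<open>a\<close> and \<open>b\<close>
  outside fixed null sets, and \<open>G\<close> vanishes almost everywhere on each curve \<open>(t\<surd>\<tau>, t/\<surd>\<tau>)\<close>,
  which gives \<open>h(\<theta>, \<tau>) = 0\<close> for every \<open>(\<theta>, \<tau>)\<close>.\<close>

section \<open>Second-order random variables\<close>

lemma integrable_mult_of_squares:
  fixes f g :: "'a \<Rightarrow> real"
  assumes [measurable]: "f \<in> borel_measurable M" "g \<in> borel_measurable M"
    and "integrable M (\<lambda>x. (f x)\<^sup>2)" "integrable M (\<lambda>x. (g x)\<^sup>2)"
  shows "integrable M (\<lambda>x. f x * g x)"
proof (rule Bochner_Integration.integrable_bound)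
  show "integrable M (\<lambda>x. (f x)\<^sup>2 + (g x)\<^sup>2)"
    using assms by simp
  have "\<bar>a * b\<bar> \<le> a\<^sup>2 + b\<^sup>2" for a b :: real
  proof -
    have "2 * (\<bar>a\<bar> * \<bar>b\<bar>) \<le> a\<^sup>2 + b\<^sup>2"
      using sum_squares_bound[of "\<bar>a\<bar>" "\<bar>b\<bar>"] by (simp add: mult.assoc)
    moreover have "0 \<le> \<bar>a\<bar> * \<bar>b\<bar>" by simp
    ultimately show ?thesis unfolding abs_mult by linarith
  qed
  then show "AE x in M. norm (f x * g x) \<le> norm ((f x)\<^sup>2 + (g x)\<^sup>2)"
    by (auto simp: abs_mult)
qed simp

text \<open>Pulls the nonnegative-integral form back to real integrals, all three of which are
  finite here. The absolute value stands inside the integral, so the bound serves both inner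
  products and products of squares.\<close>

lemma Cauchy_Schwarz_integral:
  fixes f g :: "'a \<Rightarrow> real"
  assumes [measurable]: "f \<in> borel_measurable M" "g \<in> borel_measurable M"
    and f: "integrable M (\<lambda>x. (f x)\<^sup>2)" and g: "integrable M (\<lambda>x. (g x)\<^sup>2)"
  shows "(\<integral>x. \<bar>f x * g x\<bar> \<partial>M)\<^sup>2 \<le> (\<integral>x. (f x)\<^sup>2 \<partial>M) * (\<integral>x. (g x)\<^sup>2 \<partial>M)"
proof -
  have "(\<integral>\<^sup>+x. ennreal \<bar>f x\<bar> * ennreal \<bar>g x\<bar> \<partial>M)\<^sup>2
      \<le> (\<integral>\<^sup>+x. (ennreal \<bar>f x\<bar>)\<^sup>2 \<partial>M) * (\<integral>\<^sup>+x. (ennreal \<bar>g x\<bar>)\<^sup>2 \<partial>M)"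
    by (rule Cauchy_Schwarz_nn_integral) auto
  moreover have "(\<integral>\<^sup>+x. ennreal \<bar>f x\<bar> * ennreal \<bar>g x\<bar> \<partial>M) = ennreal (\<integral>x. \<bar>f x * g x\<bar> \<partial>M)"
    using integrable_abs[OF integrable_mult_of_squares[OF assms]]
    by (subst nn_integral_eq_integral[symmetric]) (auto simp: abs_mult ennreal_mult)
  moreover have "(\<integral>\<^sup>+x. (ennreal \<bar>f x\<bar>)\<^sup>2 \<partial>M) = ennreal (\<integral>x. (f x)\<^sup>2 \<partial>M)"
    using f by (subst nn_integral_eq_integral[symmetric]) (auto simp: ennreal_power)
  moreover have "(\<integral>\<^sup>+x. (ennreal \<bar>g x\<bar>)\<^sup>2 \<partial>M) = ennreal (\<integral>x. (g x)\<^sup>2 \<partial>M)"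
    using g by (subst nn_integral_eq_integral[symmetric]) (auto simp: ennreal_power)
  ultimately show ?thesis
    by (simp add: ennreal_power flip: ennreal_mult)
qed

lemma square_integrableD:
  assumes "square_integrable M f"
  shows "f \<in> borel_measurable M" "integrable M (\<lambda>x. (cmod (f x))\<^sup>2)"
  using assms by (auto simp: square_integrable_def)

lemma square_integrable_add:
  assumes f: "square_integrable M f" and g: "square_integrable M g"
  shows "square_integrable M (\<lambda>x. f x + g x)"
proof -
  note [measurable] = square_integrableD(1)[OF f] square_integrableD(1)[OF g]
  have "(cmod (f x + g x))\<^sup>2 \<le> 2 * (cmod (f x))\<^sup>2 + 2 * (cmod (g x))\<^sup>2" for x
  proof -
    have "(cmod (f x + g x))\<^sup>2 \<le> (cmod (f x) + cmod (g x))\<^sup>2"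
      by (intro power_mono norm_triangle_ineq) auto
    also have "\<dots> \<le> 2 * (cmod (f x))\<^sup>2 + 2 * (cmod (g x))\<^sup>2"
      using sum_squares_bound[of "cmod (f x)" "cmod (g x)"] by (simp add: power2_sum)
    finally show ?thesis .
  qed
  note bound = this
  have "integrable M (\<lambda>x. (cmod (f x + g x))\<^sup>2)"
  proof (rule Bochner_Integration.integrable_bound)
    show "integrable M (\<lambda>x. 2 * (cmod (f x))\<^sup>2 + 2 * (cmod (g x))\<^sup>2)"
      using square_integrableD(2)[OF f] square_integrableD(2)[OF g] by simp
    show "AE x in M. norm ((cmod (f x + g x))\<^sup>2) \<le> norm (2 * (cmod (f x))\<^sup>2 + 2 * (cmod (g x))\<^sup>2)"
      using bound by (simp add: abs_of_nonneg)
  qed simp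
  then show ?thesis
    by (simp add: square_integrable_def)
qed

lemma square_integrable_cmult:
  assumes "square_integrable M f"
  shows "square_integrable M (\<lambda>x. c * f x)"
  using assms by (auto simp: square_integrable_def norm_mult power_mult_distrib)

lemma square_integrable_diff:
  assumes "square_integrable M f" "square_integrable M g"
  shows "square_integrable M (\<lambda>x. f x - g x)"
  using square_integrable_add[OF assms(1) square_integrable_cmult[OF assms(2), of "-1"]] by simp

lemma square_integrable_mult_bounded:
  assumes g: "square_integrable M g" and [measurable]: "f \<in> borel_measurable M"
    and b: "\<And>x. x \<in> space M \<Longrightarrow> cmod (f x) \<le> cmod (g x)"
  shows "square_integrable M f"
  unfolding square_integrable_def
proof
  show "integrable M (\<lambda>x. (cmod (f x))\<^sup>2)"
    by (rule Bochner_Integration.integrable_bound[OF square_integrableD(2)[OF g]])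
       (auto intro!: AE_I2 power_mono b)
qed simp

text \<open>Conjugate-linear in \<open>g\<close>. It acts on functions, not on classes modulo null
  sets, so for square integrable \<open>f\<close> a vanishing \<open>ms_inner M f f\<close> gives
  \<open>f = 0\<close> only almost surely.\<close>

definition ms_inner :: "'a measure \<Rightarrow> ('a \<Rightarrow> complex) \<Rightarrow> ('a \<Rightarrow> complex) \<Rightarrow> complex" where
  "ms_inner M f g = (\<integral>x. f x * cnj (g x) \<partial>M)"

lemma borel_measurable_cnj [measurable]: "cnj \<in> borel_measurable borel"
  by (intro borel_measurable_continuous_onI continuous_intros)

lemma integrable_mult_cnj:
  assumes f: "square_integrable M f" and g: "square_integrable M g"
  shows "integrable M (\<lambda>x. f x * cnj (g x))"
proof -
  note [measurable] = square_integrableD(1)[OF f] square_integrableD(1)[OF g]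
  have "integrable M (\<lambda>x. cmod (f x) * cmod (g x))"
    using square_integrableD(2)[OF f] square_integrableD(2)[OF g]
    by (intro integrable_mult_of_squares) auto
  then show ?thesis
    by (rule Bochner_Integration.integrable_bound) (auto simp: norm_mult)
qed

lemma ms_norm_nonneg: "0 \<le> ms_norm M f"
  by (simp add: ms_norm_def)

lemma ms_norm_sq: "(ms_norm M f)\<^sup>2 = (\<integral>x. (cmod (f x))\<^sup>2 \<partial>M)"
  by (simp add: ms_norm_def)

lemma ms_inner_bound:
  assumes f: "square_integrable M f" and g: "square_integrable M g"
  shows "cmod (ms_inner M f g) \<le> ms_norm M f * ms_norm M g"
proof -
  note [measurable] = square_integrableD(1)[OF f] square_integrableD(1)[OF g]
  have "cmod (ms_inner M f g) \<le> (\<integral>x. \<bar>cmod (f x) * cmod (g x)\<bar> \<partial>M)"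
    unfolding ms_inner_def by (rule order_trans[OF integral_norm_bound]) (simp add: norm_mult)
  also have "\<dots> \<le> sqrt ((\<integral>x. (cmod (f x))\<^sup>2 \<partial>M) * (\<integral>x. (cmod (g x))\<^sup>2 \<partial>M))"
    using square_integrableD(2)[OF f] square_integrableD(2)[OF g]
    by (intro real_le_rsqrt Cauchy_Schwarz_integral) auto
  also have "\<dots> = ms_norm M f * ms_norm M g"
    by (simp add: ms_norm_def real_sqrt_mult)
  finally show ?thesis .
qed

lemma ms_inner_add_left:
  assumes "square_integrable M f" "square_integrable M f'" "square_integrable M g"
  shows "ms_inner M (\<lambda>x. f x + f' x) g = ms_inner M f g + ms_inner M f' g"
  using Bochner_Integration.integral_add[OF integrable_mult_cnj[OF assms(1,3)] integrable_mult_cnj[OF assms(2,3)]]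
  by (simp add: ms_inner_def distrib_right)

lemma ms_inner_diff_left:
  assumes "square_integrable M f" "square_integrable M f'" "square_integrable M g"
  shows "ms_inner M (\<lambda>x. f x - f' x) g = ms_inner M f g - ms_inner M f' g"
  using Bochner_Integration.integral_diff[OF integrable_mult_cnj[OF assms(1,3)] integrable_mult_cnj[OF assms(2,3)]]
  by (simp add: ms_inner_def left_diff_distrib)

lemma ms_inner_cmult_left: "ms_inner M (\<lambda>x. c * f x) g = c * ms_inner M f g"
  by (simp add: ms_inner_def mult.assoc)

lemma ms_inner_commute: "ms_inner M g f = cnj (ms_inner M f g)"
proof -
  have "ms_inner M g f = (\<integral>x. cnj (f x * cnj (g x)) \<partial>M)"
    by (simp add: ms_inner_def mult.commute)
  then show ?thesis
    by (simp add: ms_inner_def del: complex_cnj_mult complex_cnj_cnj)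
qed

lemma ms_inner_self: "ms_inner M f f = of_real ((ms_norm M f)\<^sup>2)"
proof -
  have "ms_inner M f f = (\<integral>x. complex_of_real ((cmod (f x))\<^sup>2) \<partial>M)"
    unfolding ms_inner_def complex_norm_square ..
  also have "\<dots> = of_real (\<integral>x. (cmod (f x))\<^sup>2 \<partial>M)"
    by (rule integral_complex_of_real)
  finally show ?thesis
    by (simp add: ms_norm_def)
qed

text \<open>The cross term has \<open>g\<close> in the linear slot, so that a scalar factor of a
  perturbation \<open>g\<close> can be pulled out.\<close>

lemma ms_norm_add_sq:
  assumes f: "square_integrable M f" and g: "square_integrable M g"
  shows "(ms_norm M (\<lambda>x. f x + g x))\<^sup>2 = (ms_norm M f)\<^sup>2 + (ms_norm M g)\<^sup>2 + 2 * Re (ms_inner M g f)"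
proof -
  have "(cmod (f x + g x))\<^sup>2 = (cmod (f x))\<^sup>2 + (cmod (g x))\<^sup>2 + 2 * Re (g x * cnj (f x))" for x
    unfolding cmod_power2 by (simp add: power2_eq_square algebra_simps)
  moreover have "integrable M (\<lambda>x. Re (g x * cnj (f x)))"
    using integrable_mult_cnj[OF g f] by (rule integrable_Re)
  moreover have "(\<integral>x. Re (g x * cnj (f x)) \<partial>M) = Re (ms_inner M g f)"
    unfolding ms_inner_def using integrable_mult_cnj[OF g f] by (rule integral_Re)
  ultimately show ?thesis
    using square_integrableD(2)[OF f] square_integrableD(2)[OF g]
    by (simp add: ms_norm_sq del: complex_cnj_mult times_complex.sel)
qed

lemma ms_norm_triangle:
  assumes f: "square_integrable M f" and g: "square_integrable M g"
  shows "ms_norm M (\<lambda>x. f x + g x) \<le> ms_norm M f + ms_norm M g"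
proof (rule power2_le_imp_le)
  have "Re (ms_inner M g f) \<le> ms_norm M g * ms_norm M f"
    using ms_inner_bound[OF g f] complex_Re_le_cmod order_trans by blast
  then show "(ms_norm M (\<lambda>x. f x + g x))\<^sup>2 \<le> (ms_norm M f + ms_norm M g)\<^sup>2"
    unfolding ms_norm_add_sq[OF f g] by (simp add: power2_sum mult.commute)
qed (simp add: ms_norm_nonneg)

lemma square_integrable_const:
  assumes "prob_space M" shows "square_integrable M (\<lambda>_. c)"
proof -
  interpret prob_space M by fact
  show ?thesis by (simp add: square_integrable_def)
qed

section \<open>Mean-square integrals\<close>

text \<open>The preimages differ by a null set, which completeness makes measurable. It supplies the
  measurability of scalar pairings that are known only as almost everywhere limits.\<close>

lemma (in complete_measure) borel_measurable_AE_eq: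
  fixes f g :: "'a \<Rightarrow> 'b::topological_space"
  assumes f: "f \<in> borel_measurable M" and ae: "AE x in M. f x = g x"
  shows "g \<in> borel_measurable M"
proof (rule borel_measurableI)
  fix S :: "'b set" assume "open S"
  show "g -` S \<inter> space M \<in> sets M"
  proof (rule in_sets_AE)
    show "AE x in M. (x \<in> f -` S \<inter> space M) = (x \<in> g -` S \<inter> space M)"
      using ae by eventually_elim auto
    show "f -` S \<inter> space M \<in> sets M"
      using f \<open>open S\<close> by (simp add: measurable_sets)
  qed simp
qed

lemma complete_measure_lebesgue_on:
  assumes "S \<in> sets lebesgue"
  shows "complete_measure (lebesgue_on S)"
proof
  fix A B assume B: "B \<subseteq> A" and A: "A \<in> null_sets (lebesgue_on S)"
  have "A \<in> null_sets lebesgue" "A \<subseteq> S"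
    using A assms by (auto simp: null_sets_restrict_space)
  then have "B \<in> sets lebesgue" "B \<subseteq> S"
    using B completion.complete by auto
  then show "B \<in> sets (lebesgue_on S)"
    using assms by (simp add: sets_restrict_space_iff)
qed

section \<open>Pairing a mean-square integral with a fixed variable\<close>

lemma square_integrable_step_val:
  assumes "step_data M N s"
  shows "square_integrable M (step_val s u)"
  using assms
proof (induction s)
  case Nil
  then show ?case by (simp add: step_val_def[abs_def] square_integrable_def)
next
  case (Cons p s)
  obtain B Z where p: "p = (B, Z)" by fastforce
  have "square_integrable M (\<lambda>\<omega>. indicator B u * Z \<omega> + step_val s u \<omega>)"
    using Cons by (intro square_integrable_add square_integrable_cmult) (auto simp: step_data_def p)
  then show ?case
    by (simp add: step_val_def[abs_def] p)
qed

lemma square_integrable_step_int: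
  assumes "step_data M N s"
  shows "square_integrable M (step_int N s)"
  using assms
proof (induction s)
  case Nil
  then show ?case by (simp add: step_int_def[abs_def] square_integrable_def)
next
  case (Cons p s)
  obtain B Z where p: "p = (B, Z)" by fastforce
  have "square_integrable M (\<lambda>\<omega>. of_real (measure N B) * Z \<omega> + step_int N s \<omega>)"
    using Cons by (intro square_integrable_add square_integrable_cmult) (auto simp: step_data_def p)
  then show ?case
    by (simp add: step_int_def[abs_def] p)
qed

text \<open>The sets of the list may overlap. Both sides are additive along the list, so induction
  reduces the claim to a single indicator.\<close>

lemma has_bochner_integral_ms_inner_step:
  assumes "step_data M N s" and e: "square_integrable M e"
  shows "has_bochner_integral N (\<lambda>u. ms_inner M (step_val s u) e) (ms_inner M (step_int N s) e)"
  using assms(1)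
proof (induction s)
  case Nil
  then show ?case by (simp add: step_val_def[abs_def] step_int_def[abs_def] ms_inner_def has_bochner_integral_zero)
next
  case (Cons p s)
  obtain B Z where p: "p = (B, Z)" by fastforce
  have s: "step_data M N s" and Z: "square_integrable M Z"
    and B: "B \<in> sets N" "emeasure N B < \<infinity>"
    using Cons.prems by (auto simp: step_data_def p)
  have "step_val (p # s) u = (\<lambda>\<omega>. indicator B u * Z \<omega> + step_val s u \<omega>)" for u
    by (simp add: step_val_def[abs_def] p)
  then have 1: "ms_inner M (step_val (p # s) u) e = indicator B u *\<^sub>R ms_inner M Z e + ms_inner M (step_val s u) e" for u
    using Z e square_integrable_step_val[OF s]
    by (simp add: ms_inner_add_left square_integrable_cmult ms_inner_cmult_left split: split_indicator)
  have "step_int N (p # s) = (\<lambda>\<omega>. of_real (measure N B) * Z \<omega> + step_int N s \<omega>)"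
    by (simp add: step_int_def[abs_def] p)
  then have 2: "ms_inner M (step_int N (p # s)) e = measure N B *\<^sub>R ms_inner M Z e + ms_inner M (step_int N s) e"
    using Z e square_integrable_step_int[OF s]
    by (simp add: ms_inner_add_left square_integrable_cmult ms_inner_cmult_left scaleR_conv_of_real)
  show ?case
    unfolding 1 2
  proof (rule has_bochner_integral_add)
    have "has_bochner_integral N (indicator B :: _ \<Rightarrow> real) (measure N B)"
      using has_bochner_integral_real_indicator[OF B] .
    then show "has_bochner_integral N (\<lambda>u. indicator B u *\<^sub>R ms_inner M Z e) (measure N B *\<^sub>R ms_inner M Z e)"
      by (rule has_bochner_integral_scaleR_left)
    show "has_bochner_integral N (\<lambda>u. ms_inner M (step_val s u) e) (ms_inner M (step_int N s) e)"
      by (rule Cons.IH[OF s])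
  qed
qed

text \<open>Along a subsequence \<open>d n\<close> tends to 0 almost everywhere, so \<open>f\<close>
  is an almost everywhere limit of the \<open>F n\<close> and measurable by completeness. Then the
  integral of \<open>f\<close> differs from \<open>I n\<close> by at most the integral of
  \<open>d n\<close>.\<close>

lemma has_bochner_integral_L1_limit:
  fixes f :: "'u \<Rightarrow> 'b::{banach, second_countable_topology}" and F :: "nat \<Rightarrow> 'u \<Rightarrow> 'b"
  assumes "complete_measure N"
    and F: "\<And>n. has_bochner_integral N (F n) (I n)"
    and d: "\<And>n. d n \<in> borel_measurable N"
    and bound: "\<And>n u. u \<in> space N \<Longrightarrow> norm (f u - F n u) \<le> d n u"
    and lim: "(\<lambda>n. \<integral>\<^sup>+u. ennreal (d n u) \<partial>N) \<longlonglongrightarrow> 0"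
    and I: "I \<longlonglongrightarrow> L"
  shows "has_bochner_integral N f L"
proof -
  interpret complete_measure N by fact
  note [measurable] = d
  have [measurable]: "F n \<in> borel_measurable N" for n
    using F[of n] by (auto simp: has_bochner_integral_iff)
  have d0: "0 \<le> d n u" if "u \<in> space N" for n u
    using order_trans[OF norm_ge_zero bound[OF that]] .
  \<comment> \<open>Finitely many \<open>d n\<close> may have an infinite integral. From the index
    \<open>k\<close> on they are integrable, and all sequences below are shifted by
    \<open>k\<close>.\<close>
  have "eventually (\<lambda>n. (\<integral>\<^sup>+u. ennreal (d n u) \<partial>N) < 1) sequentially"
    using lim by (rule order_tendstoD) simp
  then obtain k where k: "\<And>n. k \<le> n \<Longrightarrow> (\<integral>\<^sup>+u. ennreal (d n u) \<partial>N) < 1"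
    by (auto simp: eventually_sequentially)
  have di: "integrable N (d (n + k))" for n
  proof (rule integrableI_nonneg)
    show "(\<integral>\<^sup>+u. ennreal (d (n + k) u) \<partial>N) < \<infinity>"
      using less_trans[OF k[of "n + k"], of \<infinity>] by simp
  qed (auto intro!: AE_I2 d0)
  have eq: "(\<integral>\<^sup>+u. ennreal (d (n + k) u) \<partial>N) = ennreal (\<integral>u. d (n + k) u \<partial>N)" for n
    using di d0 by (intro nn_integral_eq_integral) auto
  have "(\<lambda>n. ennreal (\<integral>u. d (n + k) u \<partial>N)) \<longlonglongrightarrow> ennreal 0"
    using LIMSEQ_ignore_initial_segment[OF lim, of k] by (simp add: eq)
  then have di0: "(\<lambda>n. \<integral>u. d (n + k) u \<partial>N) \<longlonglongrightarrow> 0"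
    by (subst (asm) tendsto_ennreal_iff) (auto intro!: always_eventually integral_nonneg_AE AE_I2 d0)
  moreover have "(\<integral>u. norm (d (n + k) u) \<partial>N) = (\<integral>u. d (n + k) u \<partial>N)" for n
    using d0 by (intro Bochner_Integration.integral_cong) auto
  ultimately obtain r where r: "strict_mono r" "AE u in N. (\<lambda>n. d (r n + k) u) \<longlonglongrightarrow> 0"
    using tendsto_L1_AE_subseq[of N "\<lambda>n. d (n + k)"] di by auto
  have ae: "AE u in N. (\<lambda>n. F (r n + k) u) \<longlonglongrightarrow> f u"
    using r(2) AE_space
  proof eventually_elim
    case (elim u)
    have "(\<lambda>n. f u - F (r n + k) u) \<longlonglongrightarrow> 0"
      by (rule Lim_null_comparison[OF always_eventually elim(1)]) (intro allI bound elim(2))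
    from tendsto_diff[OF tendsto_const[of "f u"] this] show ?case by simp
  qed
  have fm: "f \<in> borel_measurable N"
  proof (rule borel_measurable_AE_eq)
    show "(\<lambda>u. lim (\<lambda>n. F (r n + k) u)) \<in> borel_measurable N"
      by measurable
    show "AE u in N. lim (\<lambda>n. F (r n + k) u) = f u"
      using ae by eventually_elim (rule limI)
  qed
  note [measurable] = fm
  have fi: "integrable N (\<lambda>u. f u - F (n + k) u)" for n
  proof (rule Bochner_Integration.integrable_bound[OF di[of n]])
    show "AE u in N. norm (f u - F (n + k) u) \<le> norm (d (n + k) u)"
      using order_trans[OF bound abs_ge_self] by (intro AE_I2) simp
  qed simp
  have fint: "integrable N f"
    using Bochner_Integration.integrable_add[OF fi[of 0], of "F k"] F[of k] by (simp add: has_bochner_integral_iff)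
  have le: "norm (integral\<^sup>L N f - I (n + k)) \<le> (\<integral>u. d (n + k) u \<partial>N)" for n
  proof -
    have "integral\<^sup>L N f - I (n + k) = (\<integral>u. f u - F (n + k) u \<partial>N)"
      using F[of "n + k"] fint by (simp add: has_bochner_integral_iff)
    also have "norm \<dots> \<le> (\<integral>u. norm (f u - F (n + k) u) \<partial>N)"
      by (rule integral_norm_bound)
    also have "\<dots> \<le> (\<integral>u. d (n + k) u \<partial>N)"
      by (rule integral_mono[OF integrable_norm[OF fi] di bound])
    finally show ?thesis .
  qed
  have "(\<lambda>n. integral\<^sup>L N f - I (n + k)) \<longlonglongrightarrow> 0"
    by (rule Lim_null_comparison[OF always_eventually di0]) (intro allI le)
  from tendsto_diff[OF tendsto_const[of "integral\<^sup>L N f"] this]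
  have "(\<lambda>n. I (n + k)) \<longlonglongrightarrow> integral\<^sup>L N f" by simp
  from LIMSEQ_unique[OF this LIMSEQ_ignore_initial_segment[OF I, of k]] have "integral\<^sup>L N f = L" .
  with fint show ?thesis
    unfolding has_bochner_integral_iff by (rule conjI)
qed

text \<open>By Cauchy-Schwarz the pairing of \<open>f u - step_val (s n) u\<close> with
  \<open>e\<close> is at most the mean-square distance times the norm of \<open>e\<close>, so the
  approximation by step functions becomes L1 convergence of scalar functions. Besides the square
  integrability in the definition, this weak form is all that is used below about mean-square
  integrals.\<close>

proposition has_ms_integral_ms_inner:
  assumes N: "complete_measure N" and f: "has_ms_integral M N f Y" and e: "square_integrable M e"
  shows "has_bochner_integral N (\<lambda>u. ms_inner M (f u) e) (ms_inner M Y e)"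
proof -
  obtain s where fu: "\<And>u. u \<in> space N \<Longrightarrow> square_integrable M (f u)" and Y: "square_integrable M Y"
    and s: "\<And>n::nat. step_data M N (s n)"
    and m: "\<And>n. (\<lambda>u. ms_norm M (\<lambda>\<omega>. f u \<omega> - step_val (s n) u \<omega>)) \<in> borel_measurable N"
    and lim: "(\<lambda>n. \<integral>\<^sup>+u. ennreal (ms_norm M (\<lambda>\<omega>. f u \<omega> - step_val (s n) u \<omega>)) \<partial>N) \<longlonglongrightarrow> 0"
    and Ylim: "(\<lambda>n. ms_norm M (\<lambda>\<omega>. Y \<omega> - step_int N (s n) \<omega>)) \<longlonglongrightarrow> 0"
    using f unfolding has_ms_integral_def by blast
  show ?thesis
  proof (rule has_bochner_integral_L1_limit[OF N])
    show "has_bochner_integral N (\<lambda>u. ms_inner M (step_val (s n) u) e) (ms_inner M (step_int N (s n)) e)" for n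
      by (rule has_bochner_integral_ms_inner_step[OF s e])
    let ?d = "\<lambda>n u. ms_norm M e * ms_norm M (\<lambda>\<omega>. f u \<omega> - step_val (s n) u \<omega>)"
    show "?d n \<in> borel_measurable N" for n
      using m by measurable
    show "norm (ms_inner M (f u) e - ms_inner M (step_val (s n) u) e) \<le> ?d n u" if "u \<in> space N" for n u
      using ms_inner_bound[OF square_integrable_diff[OF fu[OF that] square_integrable_step_val[OF s]] e]
      by (simp add: ms_inner_diff_left fu[OF that] square_integrable_step_val[OF s] e mult.commute)
    have "(\<lambda>n. ennreal (ms_norm M e) * (\<integral>\<^sup>+u. ennreal (ms_norm M (\<lambda>\<omega>. f u \<omega> - step_val (s n) u \<omega>)) \<partial>N))
        \<longlonglongrightarrow> ennreal (ms_norm M e) * 0"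
      by (intro ennreal_tendsto_cmult lim) simp
    then show "(\<lambda>n. \<integral>\<^sup>+u. ennreal (?d n u) \<partial>N) \<longlonglongrightarrow> 0"
      using m by (simp add: ennreal_mult ms_norm_nonneg nn_integral_cmult)
    have "(\<lambda>n. ms_inner M Y e - ms_inner M (step_int N (s n)) e) \<longlonglongrightarrow> 0"
    proof (rule Lim_null_comparison)
      show "\<forall>\<^sub>F n in sequentially. norm (ms_inner M Y e - ms_inner M (step_int N (s n)) e)
          \<le> ms_norm M (\<lambda>\<omega>. Y \<omega> - step_int N (s n) \<omega>) * ms_norm M e"
        using ms_inner_bound[OF square_integrable_diff[OF Y square_integrable_step_int[OF s]] e]
        by (simp add: ms_inner_diff_left Y square_integrable_step_int[OF s] e)
      show "(\<lambda>n. ms_norm M (\<lambda>\<omega>. Y \<omega> - step_int N (s n) \<omega>) * ms_norm M e) \<longlonglongrightarrow> 0"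
        using tendsto_mult_right[OF Ylim, of "ms_norm M e"] by simp
    qed
    from tendsto_diff[OF tendsto_const[of "ms_inner M Y e"] this]
    show "(\<lambda>n. ms_inner M (step_int N (s n)) e) \<longlonglongrightarrow> ms_inner M Y e" by simp
  qed
qed

lemma has_ms_integral_ms_integral:
  "ms_integrable M N f \<Longrightarrow> has_ms_integral M N f (ms_integral M N f)"
  using someI_ex[of "has_ms_integral M N f"] by (simp only: ms_integrable_def ms_integral_def)

section \<open>Separability of measurable processes\<close>

lemma section_subset_space:
  assumes "C \<in> sets (N \<Otimes>\<^sub>M M)"
  shows "Pair t -` C \<subseteq> space M"
  using sets.sets_into_space[OF assms] by (auto simp: space_pair_measure)

text \<open>The sets with this property form a sigma-algebra containing the rectangles
  \<open>a \<times> b\<close>, whose sections are \<open>b\<close> or empty.\<close>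

lemma (in finite_measure) countable_approx_sections:
  assumes "C \<in> sets (N \<Otimes>\<^sub>M M)"
  shows "\<exists>D. countable D \<and> D \<subseteq> sets M \<and>
    (\<forall>t\<in>space N. \<forall>\<epsilon>>0. \<exists>B\<in>D. measure M (sym_diff (Pair t -` C) B) < \<epsilon>)"
  using assms unfolding sets_pair_measure
proof (induction rule: sigma_sets.induct)
  case (Basic C)
  then obtain a b where ab: "a \<in> sets N" "b \<in> sets M" "C = a \<times> b" by auto
  have "\<exists>B\<in>{b, {}}. measure M (sym_diff (Pair t -` C) B) < \<epsilon>" if "\<epsilon> > 0" for t and \<epsilon> :: real
    using that by (cases "t \<in> a") (auto simp: ab(3))
  then show ?case
    using ab(2) by (intro exI[of _ "{b, {}}"]) auto
next
  case Empty
  show ?case by (intro exI[of _ "{{}}"]) auto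
next
  case (Compl C)
  then obtain D where D: "countable D" "D \<subseteq> sets M"
    and approx: "\<And>t \<epsilon>. t \<in> space N \<Longrightarrow> \<epsilon> > 0 \<Longrightarrow> \<exists>B\<in>D. measure M (sym_diff (Pair t -` C) B) < \<epsilon>" by blast
  have C: "C \<in> sets (N \<Otimes>\<^sub>M M)"
    using Compl.hyps unfolding sets_pair_measure .
  have "\<exists>B\<in>(\<lambda>B. space M - B) ` D. measure M (sym_diff (Pair t -` (space N \<times> space M - C)) B) < \<epsilon>"
    if t: "t \<in> space N" and \<epsilon>: "\<epsilon> > 0" for t \<epsilon>
  proof -
    obtain B where B: "B \<in> D" "measure M (sym_diff (Pair t -` C) B) < \<epsilon>"
      using approx[OF t \<epsilon>] by blast
    have "B \<subseteq> space M"
      using D(2) B(1) sets.sets_into_space by blast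
    then have eq: "sym_diff (Pair t -` (space N \<times> space M - C)) (space M - B) = sym_diff (Pair t -` C) B"
      using section_subset_space[OF C, of t] t by auto
    show ?thesis
      using B(2) unfolding eq[symmetric] by (rule bexI[OF _ imageI[OF B(1)]])
  qed
  then show ?case
    using D by (intro exI[of _ "(\<lambda>B. space M - B) ` D"]) auto
next
  case (Union C)
  have C[measurable]: "C i \<in> sets (N \<Otimes>\<^sub>M M)" for i
    using Union.hyps unfolding sets_pair_measure .
  have "\<forall>i. \<exists>D. countable D \<and> D \<subseteq> sets M \<and>
      (\<forall>t\<in>space N. \<forall>\<epsilon>>0. \<exists>B\<in>D. measure M (sym_diff (Pair t -` C i) B) < \<epsilon>)"
    by (rule allI) (rule Union.IH)
  from choice[OF this] obtain D where D': "\<forall>i. countable (D i) \<and> D i \<subseteq> sets M \<and>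
      (\<forall>t\<in>space N. \<forall>\<epsilon>>0. \<exists>B\<in>D i. measure M (sym_diff (Pair t -` C i) B) < \<epsilon>)" ..
  note D = D'[THEN spec, THEN conjunct1] D'[THEN spec, THEN conjunct2, THEN conjunct1]
  note approx = D'[THEN spec, THEN conjunct2, THEN conjunct2, THEN bspec, THEN spec, THEN mp]
  \<comment> \<open>Finite unions of approximants are still countably many, and they suffice because
    finitely many \<open>C i\<close> exhaust a section of the union up to small measure.\<close>
  define D' where "D' = Union ` {F. finite F \<and> F \<subseteq> (\<Union>i. D i)}"
  have 3: "\<exists>B\<in>D'. measure M (sym_diff (Pair t -` (\<Union>i. C i)) B) < \<epsilon>"
    if t: "t \<in> space N" and \<epsilon>: "\<epsilon> > 0" for t \<epsilon>
  proof -
    define A where "A i = Pair t -` C i" for i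
    have A[measurable]: "A i \<in> sets M" for i
      unfolding A_def by (rule sets_Pair1[OF C])
    have "(\<lambda>n. measure M (\<Union>i<n. A i)) \<longlonglongrightarrow> measure M (\<Union>n. \<Union>i<n. A i)"
      by (rule finite_Lim_measure_incseq) (auto simp: incseq_def intro: less_le_trans)
    moreover have "(\<Union>n. \<Union>i<n. A i) = (\<Union>i. A i)" by auto
    ultimately have "\<forall>\<^sub>F n in sequentially. measure M (\<Union>i. A i) - \<epsilon> / 2 < measure M (\<Union>i<n. A i)"
      using \<epsilon> by (intro order_tendstoD(1)) auto
    then obtain n where n: "measure M (\<Union>i. A i) - \<epsilon> / 2 < measure M (\<Union>i<n. A i)"
      by (auto simp: eventually_sequentially)
    \<comment> \<open>The tolerance depends on \<open>n\<close>, so it is chosen after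
      \<open>n\<close>: the \<open>n\<close> errors add up to at most \<epsilon>/2, and the
      \<open>+ 1\<close> covers \<open>n = 0\<close>.\<close>
    have "\<exists>B\<in>D i. measure M (sym_diff (A i) B) < \<epsilon> / (2 * (real n + 1))" for i
      unfolding A_def by (rule approx[OF t]) (simp add: \<epsilon>)
    then have "\<forall>i. \<exists>B. B \<in> D i \<and> measure M (sym_diff (A i) B) < \<epsilon> / (2 * (real n + 1))"
      unfolding Bex_def by (rule allI)
    from choice[OF this] obtain B where
      B': "\<forall>i. B i \<in> D i \<and> measure M (sym_diff (A i) (B i)) < \<epsilon> / (2 * (real n + 1))" ..
    have B: "B i \<in> D i" "measure M (sym_diff (A i) (B i)) < \<epsilon> / (2 * (real n + 1))" for i
      using B' by simp_all
    have [measurable]: "B i \<in> sets M" for i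
      using B(1) D(2) by blast
    have "measure M (sym_diff (\<Union>i. A i) (\<Union>i<n. B i))
        \<le> measure M (((\<Union>i. A i) - (\<Union>i<n. A i)) \<union> (\<Union>i<n. sym_diff (A i) (B i)))"
      by (rule finite_measure_mono) auto
    also have "\<dots> \<le> measure M ((\<Union>i. A i) - (\<Union>i<n. A i)) + measure M (\<Union>i<n. sym_diff (A i) (B i))"
      by (rule measure_Un_le) auto
    also have "measure M ((\<Union>i. A i) - (\<Union>i<n. A i)) = measure M (\<Union>i. A i) - measure M (\<Union>i<n. A i)"
      by (rule finite_measure_Diff) auto
    also have "measure M (\<Union>i<n. sym_diff (A i) (B i)) \<le> (\<Sum>i<n. measure M (sym_diff (A i) (B i)))"
      by (rule measure_UNION_le) auto
    also have "\<dots> \<le> (\<Sum>i<n. \<epsilon> / (2 * (real n + 1)))"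
      by (intro sum_mono less_imp_le B(2))
    also have "\<dots> \<le> \<epsilon> / 2"
      using \<epsilon> by (simp add: field_simps)
    finally have "measure M (sym_diff (\<Union>i. A i) (\<Union>i<n. B i)) < \<epsilon>"
      using n by linarith
    moreover have "(\<Union>i<n. B i) \<in> D'"
      unfolding D'_def using B(1) by (intro image_eqI[of _ _ "B ` {..<n}"]) auto
    moreover have "(\<Union>i. A i) = Pair t -` (\<Union>i. C i)"
      by (auto simp: A_def)
    ultimately show ?thesis by auto
  qed
  have 1: "countable D'"
    unfolding D'_def using D(1) by (intro countable_image countable_Collect_finite_subset) auto
  have 2: "D' \<subseteq> sets M"
  proof
    fix B assume "B \<in> D'"
    then obtain F where F: "finite F" "F \<subseteq> (\<Union>i. D i)" "B = \<Union>F" by (auto simp: D'_def)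
    then have "F \<subseteq> sets M" using D(2) by blast
    then show "B \<in> sets M" using F by (auto intro: sets.finite_Union)
  qed
  show ?case
  proof (rule exI[of _ D'], rule conjI[OF 1 conjI[OF 2]], rule ballI, rule allI, rule impI)
    fix t and \<epsilon> :: real assume "t \<in> space N" "0 < \<epsilon>"
    then show "\<exists>B\<in>D'. measure M (sym_diff (Pair t -` (\<Union>i. C i)) B) < \<epsilon>" by (rule 3)
  qed
qed

section \<open>Approximation and separability in the fourth mean\<close>

lemma power4_sum_le: "(a + b) ^ 4 \<le> 8 * (a ^ 4 + b ^ 4)" for a b :: real
proof -
  have sq: "(x + y)\<^sup>2 \<le> 2 * (x\<^sup>2 + y\<^sup>2)" for x y :: real
    using sum_squares_bound[of x y] by (simp add: power2_sum)
  have "(a + b) ^ 4 = ((a + b)\<^sup>2)\<^sup>2" by simp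
  also have "\<dots> \<le> (2 * (a\<^sup>2 + b\<^sup>2))\<^sup>2"
    by (intro power_mono sq) simp
  also have "\<dots> = 4 * (a\<^sup>2 + b\<^sup>2)\<^sup>2" unfolding power_mult_distrib by simp
  also have "\<dots> \<le> 4 * (2 * ((a\<^sup>2)\<^sup>2 + (b\<^sup>2)\<^sup>2))"
    by (intro mult_left_mono sq) simp
  finally show ?thesis by simp
qed

text \<open>Stands in for Minkowski's inequality in L4: the fourth power of the distance obeys the
  triangle inequality up to the factor 8, which is harmless in density arguments.\<close>

lemma cmod_diff_power4_le: "cmod (x - z) ^ 4 \<le> 8 * (cmod (x - y) ^ 4 + cmod (y - z) ^ 4)"
proof -
  have "cmod (x - z) ^ 4 \<le> (cmod (x - y) + cmod (y - z)) ^ 4"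
    using norm_triangle_ineq[of "x - y" "y - z"] by (intro power_mono) auto
  then show ?thesis using power4_sum_le by (rule order_trans)
qed

lemma integrable_cmod_diff_power4:
  fixes f g :: "'a \<Rightarrow> complex"
  assumes [measurable]: "f \<in> borel_measurable M" "g \<in> borel_measurable M"
    and f: "integrable M (\<lambda>x. cmod (f x) ^ 4)" and g: "integrable M (\<lambda>x. cmod (g x) ^ 4)"
  shows "integrable M (\<lambda>x. cmod (f x - g x) ^ 4)"
proof (rule Bochner_Integration.integrable_bound)
  show "integrable M (\<lambda>x. 8 * (cmod (f x) ^ 4 + cmod (g x) ^ 4))"
    using f g by simp
  show "AE x in M. norm (cmod (f x - g x) ^ 4) \<le> norm (8 * (cmod (f x) ^ 4 + cmod (g x) ^ 4))"
    \<comment> \<open>The intermediate point is 0.\<close>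
    using cmod_diff_power4_le[of "f x" "g x" 0 for x] by simp
qed simp

lemma integral_cmod_diff_power4_le:
  fixes f g h :: "'a \<Rightarrow> complex"
  assumes m: "f \<in> borel_measurable M" "g \<in> borel_measurable M" "h \<in> borel_measurable M"
    and f: "integrable M (\<lambda>x. cmod (f x) ^ 4)" and g: "integrable M (\<lambda>x. cmod (g x) ^ 4)"
    and h: "integrable M (\<lambda>x. cmod (h x) ^ 4)"
  shows "(\<integral>x. cmod (f x - h x) ^ 4 \<partial>M)
    \<le> 8 * ((\<integral>x. cmod (f x - g x) ^ 4 \<partial>M) + (\<integral>x. cmod (g x - h x) ^ 4 \<partial>M))"
proof -
  note fg = integrable_cmod_diff_power4[OF m(1,2) f g]
  note gh = integrable_cmod_diff_power4[OF m(2,3) g h]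
  have "(\<integral>x. cmod (f x - h x) ^ 4 \<partial>M) \<le> (\<integral>x. 8 * (cmod (f x - g x) ^ 4 + cmod (g x - h x) ^ 4) \<partial>M)"
    using fg gh by (intro integral_mono integrable_cmod_diff_power4[OF m(1,3) f h] cmod_diff_power4_le) simp
  also have "\<dots> = 8 * ((\<integral>x. cmod (f x - g x) ^ 4 \<partial>M) + (\<integral>x. cmod (g x - h x) ^ 4 \<partial>M))"
    using fg gh by simp
  finally show ?thesis .
qed

lemma (in finite_measure) integrable_power4_bounded:
  fixes f :: "'a \<Rightarrow> complex"
  assumes [measurable]: "f \<in> borel_measurable M" and b: "\<And>x. x \<in> space M \<Longrightarrow> cmod (f x) \<le> K"
  shows "integrable M (\<lambda>x. cmod (f x) ^ 4)"
proof (rule Bochner_Integration.integrable_bound)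
  show "integrable M (\<lambda>x. K ^ 4)" by simp
  show "AE x in M. norm (cmod (f x) ^ 4) \<le> norm (K ^ 4)"
    using b by (intro AE_I2) (simp add: power_mono)
qed simp

text \<open>Each of the finitely many level sets of \<open>f\<close> is replaced by a set from a
  countable family that approximates its sections. There are countably many ways to do so, because
  the range of \<open>f\<close> is finite.\<close>

lemma (in finite_measure) countable_approx_simple_function:
  fixes f :: "'t \<times> 'a \<Rightarrow> complex"
  assumes f: "simple_function (N \<Otimes>\<^sub>M M) f"
  shows "\<exists>D. countable D \<and>
    (\<forall>g\<in>D. g \<in> borel_measurable M \<and> integrable M (\<lambda>\<omega>. cmod (g \<omega>) ^ 4)) \<and>
    (\<forall>t\<in>space N. \<forall>\<epsilon>>0. \<exists>g\<in>D. (\<integral>\<omega>. cmod (f (t, \<omega>) - g \<omega>) ^ 4 \<partial>M) < \<epsilon>)"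
proof -
  define R where "R = f ` space (N \<Otimes>\<^sub>M M)"
  have R: "finite R"
    using f by (simp add: R_def simple_function_def)
  define C where "C y = f -` {y} \<inter> space (N \<Otimes>\<^sub>M M)" for y
  have Cm: "C y \<in> sets (N \<Otimes>\<^sub>M M)" for y
    unfolding C_def by (rule simple_functionD(2)[OF f])
  then have "\<exists>D. countable D \<and> D \<subseteq> sets M \<and>
    (\<forall>t\<in>space N. \<forall>\<epsilon>>0. \<exists>B\<in>D. measure M (sym_diff (Pair t -` C y) B) < \<epsilon>)" for y
    by (rule countable_approx_sections)
  then obtain D where D: "\<And>y. countable (D y)" "\<And>y. D y \<subseteq> sets M"
    and approx: "\<And>y t \<epsilon>. t \<in> space N \<Longrightarrow> \<epsilon> > 0 \<Longrightarrow> \<exists>B\<in>D y. measure M (sym_diff (Pair t -` C y) B) < \<epsilon>"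
    by metis
  define g where "g B \<omega> = (\<Sum>y\<in>R. y * indicator (B y) \<omega>)" for B :: "complex \<Rightarrow> 'a set" and \<omega>
  have gm: "g B \<in> borel_measurable M" if "B \<in> PiE R D" for B
    unfolding g_def using that D(2) by (intro borel_measurable_sum borel_measurable_times borel_measurable_indicator) auto
  define K where "K = (\<Sum>y\<in>R. cmod y)"
  have K0: "0 \<le> K" by (simp add: K_def sum_nonneg)
  have gb: "cmod (g B \<omega>) \<le> K" for B \<omega>
    unfolding g_def K_def
    by (rule order_trans[OF norm_sum]) (intro sum_mono, auto simp: norm_mult split: split_indicator)
  have "\<exists>h\<in>g ` PiE R D. (\<integral>\<omega>. cmod (f (t, \<omega>) - h \<omega>) ^ 4 \<partial>M) < \<epsilon>"
    if t: "t \<in> space N" and \<epsilon>: "\<epsilon> > 0" for t \<epsilon>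
  proof -
    \<comment> \<open>The error will be at most \<open>K ^ 4 * card R * \<delta>\<close>; the added
      ones make it strictly smaller than \<epsilon> and exclude a zero denominator.\<close>
    define \<delta> where "\<delta> = \<epsilon> / ((K ^ 4 + 1) * (real (card R) + 1))"
    have \<delta>: "\<delta> > 0" using \<epsilon> K0 by (simp add: \<delta>_def add_nonneg_pos)
    from approx[OF t \<delta>] obtain B where B: "\<And>y. B y \<in> D y" "\<And>y. measure M (sym_diff (Pair t -` C y) (B y)) < \<delta>"
      by metis
    define B' where "B' = restrict B R"
    have B': "B' \<in> PiE R D" using B(1) by (simp add: B'_def)
    define S where "S y = sym_diff (Pair t -` C y) (B y)" for y
    have Sm: "S y \<in> sets M" for y
      unfolding S_def using B(1)[of y] D(2)[of y]
      by (intro sets.Un sets.Diff sets_Pair1[OF Cm]) auto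
    \<comment> \<open>Off all symmetric differences the two functions agree. On them the summand for
      \<open>y\<close> changes by at most \<open>cmod y\<close>, whence the bound
      \<open>K\<close>.\<close>
    have le: "cmod (f (t, \<omega>) - g B' \<omega>) ^ 4 \<le> K ^ 4 * indicator (\<Union>y\<in>R. S y) \<omega>" if \<omega>: "\<omega> \<in> space M" for \<omega>
    proof -
      have "f (t, \<omega>) \<in> R"
        using t \<omega> by (auto simp: R_def space_pair_measure)
      then have "f (t, \<omega>) = (\<Sum>y\<in>R. if y = f (t, \<omega>) then y else 0)"
        using R by simp
      also have "\<dots> = (\<Sum>y\<in>R. y * indicator (Pair t -` C y) \<omega>)"
        using t \<omega> by (intro sum.cong) (auto simp: C_def space_pair_measure split: split_indicator)
      finally have eq: "f (t, \<omega>) - g B' \<omega> = (\<Sum>y\<in>R. y * (indicator (Pair t -` C y) \<omega> - indicator (B y) \<omega>))"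
        by (simp add: g_def B'_def sum_subtractf right_diff_distrib)
      show ?thesis
      proof (cases "\<omega> \<in> (\<Union>y\<in>R. S y)")
        case True
        have "cmod (f (t, \<omega>) - g B' \<omega>) \<le> K"
          unfolding eq K_def
          by (rule order_trans[OF norm_sum]) (intro sum_mono, auto simp: norm_mult split: split_indicator)
        then have "cmod (f (t, \<omega>) - g B' \<omega>) ^ 4 \<le> K ^ 4" by (intro power_mono) auto
        then show ?thesis using True by simp
      next
        case False
        then have "f (t, \<omega>) - g B' \<omega> = 0"
          unfolding eq by (intro sum.neutral) (auto simp: S_def split: split_indicator)
        then show ?thesis using K0 by simp
      qed
    qed
    have Um: "(\<Union>y\<in>R. S y) \<in> sets M" using R Sm by (intro sets.finite_UN) auto
    have "(\<integral>\<omega>. cmod (f (t, \<omega>) - g B' \<omega>) ^ 4 \<partial>M) \<le> (\<integral>\<omega>. K ^ 4 * indicator (\<Union>y\<in>R. S y) \<omega> \<partial>M)"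
      using Um by (intro integral_mono' le integrable_mult_right integrable_real_indicator)
         (auto simp: less_top[symmetric])
    also have "\<dots> = K ^ 4 * measure M (\<Union>y\<in>R. S y)"
      using Um sets.sets_into_space[OF Um] by (simp add: Int_absorb2)
    also have "\<dots> \<le> K ^ 4 * (\<Sum>y\<in>R. measure M (S y))"
      using R Sm by (intro mult_left_mono measure_UNION_le) auto
    also have "\<dots> \<le> K ^ 4 * (\<Sum>y\<in>R. \<delta>)"
      using mult_left_mono[OF sum_mono[OF less_imp_le[OF B(2)[folded S_def]]], of "K ^ 4"] by simp
    also have "\<dots> = (K ^ 4 * real (card R)) * \<delta>"
      by simp
    also have "\<dots> < ((K ^ 4 + 1) * (real (card R) + 1)) * \<delta>"
      using \<delta> K0 by (intro mult_strict_right_mono) (auto simp: algebra_simps add_pos_nonneg add_nonneg_pos)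
    also have "\<dots> = \<epsilon>"
    proof -
      have "K ^ 4 + 1 > 0" "real (card R) + 1 > 0"
        by (intro add_nonneg_pos; simp)+
      then show ?thesis by (simp add: \<delta>_def)
    qed
    finally show ?thesis
      using B' by blast
  qed
  moreover have "countable (g ` PiE R D)"
    using R D(1) by (intro countable_image countable_PiE) auto
  ultimately show ?thesis
    using integrable_power4_bounded[OF gm gb] gm
    by (intro exI[of _ "g ` PiE R D"] conjI ballI) auto
qed

text \<open>Simple functions converge to \<open>f\<close> pointwise, dominated by twice its modulus.
  On a section with finite fourth moment they therefore converge in the fourth mean, and the union
  of their countable approximating families works for \<open>f\<close>.\<close>

lemma (in finite_measure) countable_approx_function:
  fixes f :: "'t \<times> 'a \<Rightarrow> complex"
  assumes f[measurable]: "f \<in> borel_measurable (N \<Otimes>\<^sub>M M)"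
  shows "\<exists>D. countable D \<and>
    (\<forall>g\<in>D. g \<in> borel_measurable M \<and> integrable M (\<lambda>\<omega>. cmod (g \<omega>) ^ 4)) \<and>
    (\<forall>t\<in>space N. integrable M (\<lambda>\<omega>. cmod (f (t, \<omega>)) ^ 4) \<longrightarrow>
      (\<forall>\<epsilon>>0. \<exists>g\<in>D. (\<integral>\<omega>. cmod (f (t, \<omega>) - g \<omega>) ^ 4 \<partial>M) < \<epsilon>))"
proof -
  from borel_measurable_implies_sequence_metric[OF f, of 0] obtain F
    where F': "(\<forall>i. simple_function (N \<Otimes>\<^sub>M M) (F i)) \<and>
      (\<forall>x\<in>space (N \<Otimes>\<^sub>M M). (\<lambda>i. F i x) \<longlonglongrightarrow> f x) \<and>
      (\<forall>i. \<forall>x\<in>space (N \<Otimes>\<^sub>M M). dist (F i x) 0 \<le> 2 * dist (f x) 0)" ..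
  then have F: "\<And>i. simple_function (N \<Otimes>\<^sub>M M) (F i)"
    and lim: "\<And>x. x \<in> space (N \<Otimes>\<^sub>M M) \<Longrightarrow> (\<lambda>i. F i x) \<longlonglongrightarrow> f x"
    and bound: "\<And>i x. x \<in> space (N \<Otimes>\<^sub>M M) \<Longrightarrow> cmod (F i x) \<le> 2 * cmod (f x)"
    by simp_all
  have "\<forall>i. \<exists>D. countable D \<and>
    (\<forall>g\<in>D. g \<in> borel_measurable M \<and> integrable M (\<lambda>\<omega>. cmod (g \<omega>) ^ 4)) \<and>
    (\<forall>t\<in>space N. \<forall>\<epsilon>>0. \<exists>g\<in>D. (\<integral>\<omega>. cmod (F i (t, \<omega>) - g \<omega>) ^ 4 \<partial>M) < \<epsilon>)"
    by (rule allI) (rule countable_approx_simple_function[OF F])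
  from choice[OF this] obtain D where D': "\<forall>i. countable (D i) \<and>
    (\<forall>g\<in>D i. g \<in> borel_measurable M \<and> integrable M (\<lambda>\<omega>. cmod (g \<omega>) ^ 4)) \<and>
    (\<forall>t\<in>space N. \<forall>\<epsilon>>0. \<exists>g\<in>D i. (\<integral>\<omega>. cmod (F i (t, \<omega>) - g \<omega>) ^ 4 \<partial>M) < \<epsilon>)" ..
  note D1 = D'[THEN spec, THEN conjunct1]
  note D2 = D'[THEN spec, THEN conjunct2, THEN conjunct1, THEN bspec, THEN conjunct1]
  note D3 = D'[THEN spec, THEN conjunct2, THEN conjunct1, THEN bspec, THEN conjunct2]
  note approx = D'[THEN spec, THEN conjunct2, THEN conjunct2, THEN bspec, THEN spec, THEN mp]
  have ex: "\<exists>g\<in>(\<Union>i. D i). (\<integral>\<omega>. cmod (f (t, \<omega>) - g \<omega>) ^ 4 \<partial>M) < \<epsilon>"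
    if t: "t \<in> space N" and i: "integrable M (\<lambda>\<omega>. cmod (f (t, \<omega>)) ^ 4)" and \<epsilon>: "\<epsilon> > 0" for t \<epsilon>
  proof -
    have p: "(t, \<omega>) \<in> space (N \<Otimes>\<^sub>M M)" if "\<omega> \<in> space M" for \<omega>
      using t that by (simp add: space_pair_measure)
    have fm [measurable]: "(\<lambda>\<omega>. f (t, \<omega>)) \<in> borel_measurable M"
      by (rule measurable_Pair2[OF f t])
    have Fm [measurable]: "(\<lambda>\<omega>. F i (t, \<omega>)) \<in> borel_measurable M" for i
      by (rule measurable_Pair2[OF borel_measurable_simple_function[OF F] t])
    have "(\<lambda>i. \<integral>\<omega>. cmod (f (t, \<omega>) - F i (t, \<omega>)) ^ 4 \<partial>M) \<longlonglongrightarrow> (\<integral>\<omega>. 0 \<partial>M)"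
    \<comment> \<open>81 is the fourth power of 3: the difference of \<open>f\<close> and
      \<open>F i\<close> is at most three times \<open>cmod f\<close>.\<close>
    proof (rule integral_dominated_convergence[where w="\<lambda>\<omega>. 81 * cmod (f (t, \<omega>)) ^ 4"])
      show "integrable M (\<lambda>\<omega>. 81 * cmod (f (t, \<omega>)) ^ 4)" using i by simp
      show "AE \<omega> in M. (\<lambda>i. cmod (f (t, \<omega>) - F i (t, \<omega>)) ^ 4) \<longlonglongrightarrow> 0"
      proof (rule AE_I2)
        fix \<omega> assume "\<omega> \<in> space M"
        from tendsto_diff[OF tendsto_const lim[OF p[OF this]], of "f (t, \<omega>)"]
        have "(\<lambda>i. cmod (f (t, \<omega>) - F i (t, \<omega>)) ^ 4) \<longlonglongrightarrow> cmod (f (t, \<omega>) - f (t, \<omega>)) ^ 4"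
          by (intro tendsto_power tendsto_norm)
        then show "(\<lambda>i. cmod (f (t, \<omega>) - F i (t, \<omega>)) ^ 4) \<longlonglongrightarrow> 0" by simp
      qed
      show "AE \<omega> in M. norm (cmod (f (t, \<omega>) - F i (t, \<omega>)) ^ 4) \<le> 81 * cmod (f (t, \<omega>)) ^ 4" for i
      proof (rule AE_I2)
        fix \<omega> assume "\<omega> \<in> space M"
        then have "cmod (f (t, \<omega>) - F i (t, \<omega>)) \<le> 3 * cmod (f (t, \<omega>))"
          using bound[OF p, of \<omega> i] norm_triangle_ineq4[of "f (t, \<omega>)" "F i (t, \<omega>)"] by linarith
        then have "cmod (f (t, \<omega>) - F i (t, \<omega>)) ^ 4 \<le> (3 * cmod (f (t, \<omega>))) ^ 4"
          by (intro power_mono) auto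
        then show "norm (cmod (f (t, \<omega>) - F i (t, \<omega>)) ^ 4) \<le> 81 * cmod (f (t, \<omega>)) ^ 4"
          by (simp add: power_mult_distrib)
      qed
    qed measurable
    \<comment> \<open>Two errors below \<epsilon>/16 and the factor 8 give a total below
      \<epsilon>.\<close>
    then have "\<forall>\<^sub>F i in sequentially. (\<integral>\<omega>. cmod (f (t, \<omega>) - F i (t, \<omega>)) ^ 4 \<partial>M) < \<epsilon> / 16"
      using \<epsilon> by (intro order_tendstoD(2)) auto
    then obtain k where k: "(\<integral>\<omega>. cmod (f (t, \<omega>) - F k (t, \<omega>)) ^ 4 \<partial>M) < \<epsilon> / 16"
      by (auto simp: eventually_sequentially)
    obtain g where g: "g \<in> D k" "(\<integral>\<omega>. cmod (F k (t, \<omega>) - g \<omega>) ^ 4 \<partial>M) < \<epsilon> / 16"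
      using approx[OF t, of "\<epsilon> / 16" k] \<epsilon> by auto
    have Fi: "integrable M (\<lambda>\<omega>. cmod (F k (t, \<omega>)) ^ 4)"
    proof (rule Bochner_Integration.integrable_bound)
      show "integrable M (\<lambda>\<omega>. 16 * cmod (f (t, \<omega>)) ^ 4)" using i by simp
      show "AE \<omega> in M. norm (cmod (F k (t, \<omega>)) ^ 4) \<le> norm (16 * cmod (f (t, \<omega>)) ^ 4)"
      proof (rule AE_I2)
        fix \<omega> assume "\<omega> \<in> space M"
        then have "cmod (F k (t, \<omega>)) ^ 4 \<le> (2 * cmod (f (t, \<omega>))) ^ 4"
          by (intro power_mono bound p) auto
        then show "norm (cmod (F k (t, \<omega>)) ^ 4) \<le> norm (16 * cmod (f (t, \<omega>)) ^ 4)"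
          by (simp add: power_mult_distrib)
      qed
    qed measurable
    have "(\<integral>\<omega>. cmod (f (t, \<omega>) - g \<omega>) ^ 4 \<partial>M)
        \<le> 8 * ((\<integral>\<omega>. cmod (f (t, \<omega>) - F k (t, \<omega>)) ^ 4 \<partial>M) + (\<integral>\<omega>. cmod (F k (t, \<omega>) - g \<omega>) ^ 4 \<partial>M))"
      by (rule integral_cmod_diff_power4_le[OF fm Fm D2[OF g(1)] i Fi D3[OF g(1)]])
    then show ?thesis using k g by (intro bexI[of _ g]) auto
  qed
  show ?thesis
  proof (intro exI[of _ "\<Union>i. D i"] conjI ballI impI allI)
    show "countable (\<Union>i. D i)" using D1 by simp
  qed (use D2 D3 ex in auto)
qed

text \<open>Subsets of a separable space are separable: the approximants in \<open>D\<close> need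
  not be sections of \<open>f\<close>, so for each of them and each precision one nearby time in
  \<open>S\<close> is kept, if there is one.\<close>

lemma (in finite_measure) countable_dense_sections:
  fixes f :: "'t \<times> 'a \<Rightarrow> complex"
  assumes f[measurable]: "f \<in> borel_measurable (N \<Otimes>\<^sub>M M)"
    and S: "S \<subseteq> space N" "\<And>t. t \<in> S \<Longrightarrow> integrable M (\<lambda>\<omega>. cmod (f (t, \<omega>)) ^ 4)"
  shows "\<exists>T. countable T \<and> T \<subseteq> S \<and>
    (\<forall>t\<in>S. \<forall>\<epsilon>>0. \<exists>u\<in>T. (\<integral>\<omega>. cmod (f (t, \<omega>) - f (u, \<omega>)) ^ 4 \<partial>M) < \<epsilon>)"
proof -
  obtain D where D0: "countable D"
    and D': "\<forall>g\<in>D. g \<in> borel_measurable M \<and> integrable M (\<lambda>\<omega>. cmod (g \<omega>) ^ 4)"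
    and approx: "\<forall>t\<in>space N. integrable M (\<lambda>\<omega>. cmod (f (t, \<omega>)) ^ 4) \<longrightarrow>
      (\<forall>\<epsilon>>0. \<exists>g\<in>D. (\<integral>\<omega>. cmod (f (t, \<omega>) - g \<omega>) ^ 4 \<partial>M) < \<epsilon>)"
    using countable_approx_function[OF f] by (elim exE conjE) (rule that)
  note D1 = D'[THEN bspec, THEN conjunct1] and D2 = D'[THEN bspec, THEN conjunct2]
  define near where "near g n t \<longleftrightarrow> t \<in> S \<and> (\<integral>\<omega>. cmod (f (t, \<omega>) - g \<omega>) ^ 4 \<partial>M) < 1 / Suc n" for g and n :: nat and t
  \<comment> \<open>Only pairs with a witness are used, so that \<open>SOME\<close> really yields a
    time in \<open>S\<close> near \<open>g\<close>.\<close>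
  define T where "T = (\<lambda>(g, n). SOME t. near g n t) ` {(g, n) \<in> D \<times> UNIV. Ex (near g n)}"
  have 1: "countable T"
  proof -
    have "countable (D \<times> (UNIV :: nat set))" using D0 by simp
    then have "countable {(g, n) \<in> D \<times> UNIV. Ex (near g n)}"
      by (rule countable_subset[rotated]) auto
    then show ?thesis unfolding T_def by (rule countable_image)
  qed
  have 2: "T \<subseteq> S"
  proof
    fix u assume "u \<in> T"
    then obtain g n where "Ex (near g n)" "u = (SOME t. near g n t)" by (auto simp: T_def)
    then have "near g n u" using someI_ex[of "near g n"] by simp
    then show "u \<in> S" by (simp add: near_def)
  qed
  have 3: "\<exists>u\<in>T. (\<integral>\<omega>. cmod (f (t, \<omega>) - f (u, \<omega>)) ^ 4 \<partial>M) < \<epsilon>"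
    if t: "t \<in> S" and \<epsilon>: "\<epsilon> > 0" for t \<epsilon>
  proof -
    obtain n :: nat where n: "1 / Suc n < \<epsilon> / 16"
      using nat_approx_posE[of "\<epsilon> / 16"] \<epsilon> by auto
    obtain g where g: "g \<in> D" "(\<integral>\<omega>. cmod (f (t, \<omega>) - g \<omega>) ^ 4 \<partial>M) < 1 / Suc n"
      using approx[THEN bspec, THEN mp, THEN spec, THEN mp, OF subsetD[OF S(1) t] S(2)[OF t], of "1 / Suc n"]
      by auto
    define u where "u = (SOME t. near g n t)"
    have ex: "near g n t" using t g(2) unfolding near_def by (rule conjI)
    then have u: "near g n u" unfolding u_def by (rule someI)
    have uT: "u \<in> T"
      unfolding u_def T_def using g(1) ex by (intro image_eqI[of _ _ "(g, n)"]) auto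
    note uS = u[unfolded near_def, THEN conjunct1] u[unfolded near_def, THEN conjunct2]
    have m: "(\<lambda>\<omega>. f (v, \<omega>)) \<in> borel_measurable M" if "v \<in> S" for v
      using measurable_Pair2[OF f] S(1) that by auto
    have "(\<integral>\<omega>. cmod (f (t, \<omega>) - f (u, \<omega>)) ^ 4 \<partial>M)
        \<le> 8 * ((\<integral>\<omega>. cmod (f (t, \<omega>) - g \<omega>) ^ 4 \<partial>M) + (\<integral>\<omega>. cmod (g \<omega> - f (u, \<omega>)) ^ 4 \<partial>M))"
      by (rule integral_cmod_diff_power4_le[OF m D1 m S(2) D2 S(2)]) (fact t uS(1) g(1))+
    also have "\<dots> < \<epsilon>"
      using g(2) uS(2) n by (simp add: norm_minus_commute)
    finally show ?thesis using uT by (rule bexI)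
  qed
  show ?thesis
  proof (rule exI[of _ T], rule conjI[OF 1 conjI[OF 2]], rule ballI, rule allI, rule impI)
    fix t and \<epsilon> :: real assume "t \<in> S" "0 < \<epsilon>"
    then show "\<exists>u\<in>T. (\<integral>\<omega>. cmod (f (t, \<omega>) - f (u, \<omega>)) ^ 4 \<partial>M) < \<epsilon>" by (rule 3)
  qed
qed

section \<open>Products of variables with finite fourth moments\<close>

lemma square_integrable_mult_power4:
  fixes f g :: "'a \<Rightarrow> complex"
  assumes [measurable]: "f \<in> borel_measurable M" "g \<in> borel_measurable M"
    and f: "integrable M (\<lambda>x. cmod (f x) ^ 4)" and g: "integrable M (\<lambda>x. cmod (g x) ^ 4)"
  shows "square_integrable M (\<lambda>x. f x * cnj (g x))"
proof -
  have "integrable M (\<lambda>x. (cmod (f x))\<^sup>2 * (cmod (g x))\<^sup>2)"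
    using f g by (intro integrable_mult_of_squares) (simp_all flip: power_mult)
  then show ?thesis
    by (simp add: square_integrable_def norm_mult power_mult_distrib)
qed

text \<open>Cauchy-Schwarz for the squared moduli. It makes the product continuous from L4 into L2
  in each factor.\<close>

lemma ms_norm_mult_power4_le:
  fixes f g :: "'a \<Rightarrow> complex"
  assumes [measurable]: "f \<in> borel_measurable M" "g \<in> borel_measurable M"
    and f: "integrable M (\<lambda>x. cmod (f x) ^ 4)" and g: "integrable M (\<lambda>x. cmod (g x) ^ 4)"
  shows "ms_norm M (\<lambda>x. f x * cnj (g x)) ^ 4 \<le> (\<integral>x. cmod (f x) ^ 4 \<partial>M) * (\<integral>x. cmod (g x) ^ 4 \<partial>M)"
proof -
  have "ms_norm M (\<lambda>x. f x * cnj (g x)) ^ 4 = ((ms_norm M (\<lambda>x. f x * cnj (g x)))\<^sup>2)\<^sup>2"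
    by simp
  also have "\<dots> = (\<integral>x. \<bar>(cmod (f x))\<^sup>2 * (cmod (g x))\<^sup>2\<bar> \<partial>M)\<^sup>2"
    by (simp add: ms_norm_sq norm_mult power_mult_distrib)
  also have "\<dots> \<le> (\<integral>x. ((cmod (f x))\<^sup>2)\<^sup>2 \<partial>M) * (\<integral>x. ((cmod (g x))\<^sup>2)\<^sup>2 \<partial>M)"
    using f g by (intro Cauchy_Schwarz_integral) (simp_all flip: power_mult)
  finally show ?thesis
    by (simp flip: power_mult)
qed

text \<open>For fixed \<open>b\<close> the form \<open>E[f\<^sub>a f\<^sub>b\<^sup>* e\<^sup>*]\<close> is \<open>L\<^sup>4\<close>-continuous in \<open>f\<^sub>a\<close>, so by
  separability only countably many exceptional null sets of \<open>b\<close> have to be avoided. The point is that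
  the resulting exceptional sets for \<open>a\<close> and \<open>b\<close> are independent of each other, which gives
  information on every single curve in the plane of pairs \<open>(a, b)\<close>.\<close>

lemma (in finite_measure) AE_pairs_imp_AE_separately:
  fixes f :: "'t \<times> 'a \<Rightarrow> complex"
  assumes f: "f \<in> borel_measurable (N \<Otimes>\<^sub>M M)"
    and f4: "\<And>t. t \<in> space N \<Longrightarrow> integrable M (\<lambda>\<omega>. cmod (f (t, \<omega>)) ^ 4)"
    and e: "square_integrable M e"
    and ae: "AE a in N. AE b in N. ms_inner M (\<lambda>\<omega>. f (a, \<omega>) * cnj (f (b, \<omega>))) e = 0"
  obtains P Q where "AE a in N. P a" "AE b in N. Q b"
    "\<And>a b. a \<in> space N \<Longrightarrow> b \<in> space N \<Longrightarrow> P a \<Longrightarrow> Q b \<Longrightarrow>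
      ms_inner M (\<lambda>\<omega>. f (a, \<omega>) * cnj (f (b, \<omega>))) e = 0"
proof -
  define G where "G a b = ms_inner M (\<lambda>\<omega>. f (a, \<omega>) * cnj (f (b, \<omega>))) e" for a b
  \<comment> \<open>For \<open>a\<close> in \<open>S\<close> the exceptional null set of
    \<open>b\<close> still depends on \<open>a\<close>. A countable dense subset \<open>T\<close> of
    \<open>S\<close> leaves only countably many such sets.\<close>
  define S where "S = {a \<in> space N. AE b in N. G a b = 0}"
  have S: "S \<subseteq> space N" by (auto simp: S_def)
  have S4: "integrable M (\<lambda>\<omega>. cmod (f (t, \<omega>)) ^ 4)" if "t \<in> S" for t
    using f4 S that by blast
  have "\<exists>T. countable T \<and> T \<subseteq> S \<and>
      (\<forall>t\<in>S. \<forall>\<epsilon>>0. \<exists>u\<in>T. (\<integral>\<omega>. cmod (f (t, \<omega>) - f (u, \<omega>)) ^ 4 \<partial>M) < \<epsilon>)"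
    by (rule countable_dense_sections[OF f S S4])
  then obtain T where T: "countable T" "T \<subseteq> S"
    and dense: "\<forall>t\<in>S. \<forall>\<epsilon>>0. \<exists>u\<in>T. (\<integral>\<omega>. cmod (f (t, \<omega>) - f (u, \<omega>)) ^ 4 \<partial>M) < \<epsilon>"
    by (elim exE conjE) (rule that)
  have m: "(\<lambda>\<omega>. f (t, \<omega>)) \<in> borel_measurable M" if "t \<in> space N" for t
    by (rule measurable_Pair2[OF f that])
  show thesis
  proof (rule that)
    \<comment> \<open>\<open>P\<close> is membership in \<open>S\<close>, and \<open>Q\<close>
      demands \<open>G u b = 0\<close> for all \<open>u\<close> in the countable set
      \<open>T\<close>; so \<open>Q\<close> does not involve \<open>a\<close>.\<close>
    show "AE a in N. a \<in> S"
      using ae AE_space by eventually_elim (simp add: S_def G_def)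
    have "AE b in N. G u b = 0" if "u \<in> T" for u
      using T(2) that by (auto simp: S_def)
    then show "AE b in N. \<forall>u\<in>T. G u b = 0"
      using T(1) by (simp add: AE_ball_countable)
    fix a b assume a: "a \<in> space N" and b: "b \<in> space N" and aS: "a \<in> S" and bT: "\<forall>u\<in>T. G u b = 0"
    define K where "K = (\<integral>\<omega>. cmod (f (b, \<omega>)) ^ 4 \<partial>M) * ms_norm M e ^ 4"
    have K0: "0 \<le> K" by (simp add: K_def)
    \<comment> \<open>Compare with some \<open>u\<close> in \<open>T\<close> close to
      \<open>a\<close>, where \<open>G u b = 0\<close>, and apply Cauchy-Schwarz twice to the
      difference.\<close>
    have "cmod (G a b) ^ 4 \<le> K * \<epsilon>" if \<epsilon>: "\<epsilon> > 0" for \<epsilon>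
    proof -
      obtain u where u: "u \<in> T" and lt: "(\<integral>\<omega>. cmod (f (a, \<omega>) - f (u, \<omega>)) ^ 4 \<partial>M) < \<epsilon>"
        using dense[THEN bspec, THEN spec, THEN mp, OF aS \<epsilon>] by (rule bexE)
      have uN: "u \<in> space N" using u T(2) S by auto
      note d4 = integrable_cmod_diff_power4[OF m[OF a] m[OF uN] f4[OF a] f4[OF uN]]
      have dm: "(\<lambda>\<omega>. f (a, \<omega>) - f (u, \<omega>)) \<in> borel_measurable M"
        using m[OF a] m[OF uN] by (rule borel_measurable_diff)
      note sa = square_integrable_mult_power4[OF m[OF a] m[OF b] f4[OF a] f4[OF b]]
      note su = square_integrable_mult_power4[OF m[OF uN] m[OF b] f4[OF uN] f4[OF b]]
      note sd = square_integrable_mult_power4[OF dm m[OF b] d4 f4[OF b]]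
      have "G a b = G a b - G u b" using bT u by simp
      also have "\<dots> = ms_inner M (\<lambda>\<omega>. (f (a, \<omega>) - f (u, \<omega>)) * cnj (f (b, \<omega>))) e"
        unfolding G_def left_diff_distrib by (rule ms_inner_diff_left[OF sa su e, symmetric])
      finally have "cmod (G a b) \<le> ms_norm M (\<lambda>\<omega>. (f (a, \<omega>) - f (u, \<omega>)) * cnj (f (b, \<omega>))) * ms_norm M e"
        using ms_inner_bound[OF sd e] by simp
      then have "cmod (G a b) ^ 4 \<le> (ms_norm M (\<lambda>\<omega>. (f (a, \<omega>) - f (u, \<omega>)) * cnj (f (b, \<omega>))) * ms_norm M e) ^ 4"
        by (rule power_mono) simp
      also have "\<dots> = ms_norm M (\<lambda>\<omega>. (f (a, \<omega>) - f (u, \<omega>)) * cnj (f (b, \<omega>))) ^ 4 * ms_norm M e ^ 4"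
        by (rule power_mult_distrib)
      also have "\<dots> \<le> ((\<integral>\<omega>. cmod (f (a, \<omega>) - f (u, \<omega>)) ^ 4 \<partial>M) * (\<integral>\<omega>. cmod (f (b, \<omega>)) ^ 4 \<partial>M)) * ms_norm M e ^ 4"
        by (rule mult_right_mono[OF ms_norm_mult_power4_le[OF dm m[OF b] d4 f4[OF b]]]) simp
      also have "\<dots> = K * (\<integral>\<omega>. cmod (f (a, \<omega>) - f (u, \<omega>)) ^ 4 \<partial>M)"
        by (simp add: K_def)
      also have "\<dots> \<le> K * \<epsilon>"
        by (rule mult_left_mono[OF less_imp_le[OF lt] K0])
      finally show ?thesis .
    qed
    note le = this
    have "cmod (G a b) ^ 4 \<le> 0"
    proof (rule field_le_epsilon)
      fix \<delta> :: real assume \<delta>: "0 < \<delta>"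
      have "cmod (G a b) ^ 4 \<le> K * (\<delta> / (K + 1))"
        using \<delta> K0 by (intro le) simp
      also have "\<dots> \<le> 0 + \<delta>"
        using \<delta> K0 by (simp add: field_simps)
      finally show "cmod (G a b) ^ 4 \<le> 0 + \<delta>" .
    qed
    then have "cmod (G a b) ^ 4 = 0"
      using zero_le_power[of "cmod (G a b)" 4] by simp
    then show "ms_inner M (\<lambda>\<omega>. f (a, \<omega>) * cnj (f (b, \<omega>))) e = 0"
      by (simp add: G_def)
  qed
qed

section \<open>Uniqueness of the Mellin transform\<close>

text \<open>Levy's uniqueness theorem, applied to the normalized positive and negative parts of \<open>f\<close>.\<close>

lemma pushforward_eq_0_if_Fourier_eq_0:
  fixes f \<phi> :: "'u \<Rightarrow> real"
  assumes f: "integrable N f" and \<phi>[measurable]: "\<phi> \<in> borel_measurable N"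
    and F0: "\<And>s. (\<integral>x. of_real (f x) * exp (\<i> * of_real (s * \<phi> x)) \<partial>N) = 0"
    and B[measurable]: "B \<in> sets borel"
  shows "(\<integral>x. f x * indicator B (\<phi> x) \<partial>N) = 0"
proof -
  note [measurable] = borel_measurable_integrable[OF f]
  define p where "p x = max 0 (f x)" for x
  define q where "q x = max 0 (- f x)" for x
  have pq: "f x = p x - q x" "0 \<le> p x" "0 \<le> q x" for x by (auto simp: p_def q_def)
  have p: "integrable N p" and q: "integrable N q"
    using f by (auto simp: p_def[abs_def] q_def[abs_def])
  note [measurable] = borel_measurable_integrable[OF p] borel_measurable_integrable[OF q]
  have bnd: "integrable N (\<lambda>x. of_real (r x) * exp (\<i> * of_real (s * \<phi> x)))" if "integrable N r" for r :: "'u \<Rightarrow> real" and s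
  proof -
    note [measurable] = borel_measurable_integrable[OF that]
    show ?thesis
      by (rule Bochner_Integration.integrable_bound[OF integrable_norm[OF that]]) (auto simp: norm_mult)
  qed
  have eq: "(\<integral>x. of_real (p x) * exp (\<i> * of_real (s * \<phi> x)) \<partial>N) = (\<integral>x. of_real (q x) * exp (\<i> * of_real (s * \<phi> x)) \<partial>N)" for s
  proof -
    have "(\<integral>x. of_real (f x) * exp (\<i> * of_real (s * \<phi> x)) \<partial>N) =
      (\<integral>x. of_real (p x) * exp (\<i> * of_real (s * \<phi> x)) \<partial>N) - (\<integral>x. of_real (q x) * exp (\<i> * of_real (s * \<phi> x)) \<partial>N)"
      unfolding pq(1) of_real_diff left_diff_distrib
      by (rule Bochner_Integration.integral_diff[OF bnd[OF p] bnd[OF q]])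
    then show ?thesis using F0[of s] by simp
  qed
  define m where "m = (\<integral>x. p x \<partial>N)"
  \<comment> \<open>Frequency 0 shows that both parts have the same mass, so the same constant
    normalizes them.\<close>
  have m: "m = (\<integral>x. q x \<partial>N)"
    using eq[of 0] by (simp add: m_def)
  have m0: "0 \<le> m" unfolding m_def by (intro integral_nonneg_AE AE_I2 pq)
  have "(\<integral>x. p x * indicator B (\<phi> x) \<partial>N) = (\<integral>x. q x * indicator B (\<phi> x) \<partial>N)"
  proof (cases "m = 0")
    case True
    then have "AE x in N. p x = 0" "AE x in N. q x = 0"
      using integral_nonneg_eq_0_iff_AE[OF p AE_I2[OF pq(2)]] integral_nonneg_eq_0_iff_AE[OF q AE_I2[OF pq(3)]] m
      by (simp_all add: m_def)
    then have "AE x in N. p x * indicator B (\<phi> x) = q x * indicator B (\<phi> x)"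
      by eventually_elim simp
    then show ?thesis by (intro integral_cong_AE) auto
  next
    case False
    then have mp: "0 < m" using m0 by simp
    \<comment> \<open>The law of \<open>\<phi>\<close> under the probability density
      \<open>r / m\<close>. Its characteristic function is the transform of \<open>r\<close> divided
      by \<open>m\<close>, so \<open>p\<close> and \<open>q\<close> give the same one.\<close>
    define D where "D r = distr (density N (\<lambda>x. ennreal (r x / m))) borel \<phi>" for r :: "'u \<Rightarrow> real"
    have prob: "real_distribution (D r)" if r: "integrable N r" "\<And>x. 0 \<le> r x" "(\<integral>x. r x \<partial>N) = m" for r
    proof -
      note [measurable] = borel_measurable_integrable[OF r(1)]
      have "emeasure (density N (\<lambda>x. ennreal (r x / m))) (space N) = (\<integral>\<^sup>+x. ennreal (r x / m) \<partial>N)"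
        by (subst emeasure_density) (auto intro!: nn_integral_cong)
      also have "\<dots> = ennreal (\<integral>x. r x / m \<partial>N)"
        using r mp by (intro nn_integral_eq_integral) auto
      also have "\<dots> = 1" using r(3) mp by simp
      finally interpret P: prob_space "density N (\<lambda>x. ennreal (r x / m))"
        by (intro prob_spaceI) simp
      show ?thesis unfolding D_def by (rule P.real_distribution_distr) measurable
    qed
    have int: "(\<integral>y. h y \<partial>D r) = (\<integral>x. (r x / m) *\<^sub>R h (\<phi> x) \<partial>N)"
      if r: "integrable N r" "\<And>x. 0 \<le> r x" and h[measurable]: "h \<in> borel_measurable borel"
      for r and h :: "real \<Rightarrow> 'c :: {banach, second_countable_topology}"
    proof -
      note [measurable] = borel_measurable_integrable[OF r(1)]
      have "(\<integral>y. h y \<partial>D r) = (\<integral>x. h (\<phi> x) \<partial>density N (\<lambda>x. ennreal (r x / m)))"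
        unfolding D_def by (rule integral_distr) measurable
      also have "\<dots> = (\<integral>x. (r x / m) *\<^sub>R h (\<phi> x) \<partial>N)"
        using r(2) mp by (intro integral_density) auto
      finally show ?thesis .
    qed
    have chr: "char (D r) s = (\<integral>x. of_real (r x) * exp (\<i> * of_real (s * \<phi> x)) \<partial>N) / of_real m"
      if r: "integrable N r" "\<And>x. 0 \<le> r x" for r s
    proof -
      have "char (D r) s = (\<integral>x. (r x / m) *\<^sub>R exp (\<i> * of_real (s * \<phi> x)) \<partial>N)"
        unfolding char_def by (rule int[OF r]) measurable
      also have "\<dots> = (\<integral>x. of_real (r x) * exp (\<i> * of_real (s * \<phi> x)) / of_real m \<partial>N)"
        by (intro Bochner_Integration.integral_cong refl) (simp add: scaleR_conv_of_real)
      also have "\<dots> = (\<integral>x. of_real (r x) * exp (\<i> * of_real (s * \<phi> x)) \<partial>N) / of_real m"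
        by (rule integral_divide_zero)
      finally show ?thesis .
    qed
    have "D p = D q"
    proof (rule Levy_uniqueness)
      show "char (D p) = char (D q)"
        by (rule ext) (simp only: chr[OF p pq(2)] chr[OF q pq(3)] eq)
    qed (rule prob[OF p pq(2) m_def[symmetric]], rule prob[OF q pq(3) m[symmetric]])
    then have "(\<integral>y. indicat_real B y \<partial>D p) = (\<integral>y. indicat_real B y \<partial>D q)" by simp
    then have "(\<integral>x. (p x / m) *\<^sub>R indicat_real B (\<phi> x) \<partial>N) = (\<integral>x. (q x / m) *\<^sub>R indicat_real B (\<phi> x) \<partial>N)"
      by (subst (asm) int[OF p pq(2)], measurable, subst (asm) int[OF q pq(3)], measurable)
    then show ?thesis using mp by simp
  qed
  moreover have "integrable N (\<lambda>x. r x * indicator B (\<phi> x))" if "integrable N r" for r :: "'u \<Rightarrow> real"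
  proof -
    note [measurable] = borel_measurable_integrable[OF that]
    show ?thesis
      by (rule Bochner_Integration.integrable_bound[OF that]) (auto split: split_indicator)
  qed
  ultimately show ?thesis
    using p q unfolding pq(1) left_diff_distrib by simp
qed

lemma borel_measurable_lebesgue_onI:
  "f \<in> borel_measurable borel \<Longrightarrow> f \<in> borel_measurable (lebesgue_on S)"
  by (intro measurable_restrict_space1 measurable_completion) simp

text \<open>In the variable \<open>ln t\<close> the Mellin transform is a Fourier transform. For the
  set \<open>B\<close> of all \<open>u\<close> with \<open>f (exp u) > 0\<close>, the vanishing
  integral over \<open>B\<close> is that of the positive part of \<open>f\<close>.\<close>

lemma AE_le_0_if_Mellin_eq_0:
  fixes f :: "real \<Rightarrow> real"
  assumes [measurable]: "f \<in> borel_measurable borel" and f: "integrable (lebesgue_on {0<..}) f"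
    and F0: "\<And>s. (\<integral>t. of_real (f t) * exp (\<i> * of_real (s * ln t)) \<partial>lebesgue_on {0<..}) = 0"
  shows "AE t in lebesgue_on {0<..}. f t \<le> 0"
proof -
  define B where "B = {u. 0 < f (exp u)}"
  have B: "B \<in> sets borel" unfolding B_def by measurable
  have "(\<integral>t. f t * indicator B (ln t) \<partial>lebesgue_on {0<..}) = 0"
    by (rule pushforward_eq_0_if_Fourier_eq_0[OF f _ F0 B]) (intro borel_measurable_lebesgue_onI, measurable)
  also have "(\<integral>t. f t * indicator B (ln t) \<partial>lebesgue_on {0<..}) = (\<integral>t. max 0 (f t) \<partial>lebesgue_on {0<..})"
    by (intro Bochner_Integration.integral_cong refl) (auto simp: B_def split: split_indicator)
  finally have "AE t in lebesgue_on {0<..}. max 0 (f t) = 0"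
    using f by (subst (asm) integral_nonneg_eq_0_iff_AE) auto
  then show ?thesis by eventually_elim simp
qed

text \<open>Conjugating the hypothesis at \<open>- s\<close> gives a vanishing transform for the
  conjugate of \<open>f\<close>, hence for its real and imaginary parts. The one-sided result
  applies to each of these and to its negative.\<close>

lemma AE_eq_0_if_Mellin_eq_0:
  fixes f :: "real \<Rightarrow> complex"
  assumes fm[measurable]: "f \<in> borel_measurable borel" and f: "integrable (lebesgue_on {0<..}) f"
    and F0: "\<And>s. (\<integral>t. f t * exp (\<i> * of_real (s * ln t)) \<partial>lebesgue_on {0<..}) = 0"
  shows "AE t in lebesgue_on {0<..}. f t = 0"
proof -
  let ?L = "lebesgue_on {0<..} :: real measure"
  have ln: "(\<lambda>t. exp (\<i> * of_real (s * ln t))) \<in> borel_measurable ?L" for s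
    by (intro borel_measurable_lebesgue_onI) measurable
  have int: "integrable ?L (\<lambda>t. f t * exp (\<i> * of_real (s * ln t)))" for s
    using borel_measurable_times[OF borel_measurable_integrable[OF f] ln]
    by (rule Bochner_Integration.integrable_bound[OF f]) (simp add: norm_mult)
  have c: "cnj (f t * exp (\<i> * of_real (- s * ln t))) = cnj (f t) * exp (\<i> * of_real (s * ln t))" for s t
    by (simp add: exp_cnj)
  have int': "integrable ?L (\<lambda>t. cnj (f t) * exp (\<i> * of_real (s * ln t)))"
    and F0': "(\<integral>t. cnj (f t) * exp (\<i> * of_real (s * ln t)) \<partial>?L) = 0" for s
    using Bochner_Integration.integrable_cnj[OF int[of "- s"]] Bochner_Integration.integral_cnj[of ?L "\<lambda>t. f t * exp (\<i> * of_real (- s * ln t))"] F0[of "- s"]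
    unfolding c by simp_all
  have re: "of_real (Re z) = (z + cnj z) / 2" and im: "of_real (Im z) = (z - cnj z) / (2 * \<i>)" for z
    by (simp_all add: complex_eq_iff)
  have "(\<integral>t. of_real (Re (f t)) * exp (\<i> * of_real (s * ln t)) \<partial>?L) = 0" for s
  proof -
    have "(\<integral>t. of_real (Re (f t)) * exp (\<i> * of_real (s * ln t)) \<partial>?L) =
      (\<integral>t. (f t * exp (\<i> * of_real (s * ln t)) + cnj (f t) * exp (\<i> * of_real (s * ln t))) / 2 \<partial>?L)"
      unfolding re by (simp add: algebra_simps add_divide_distrib)
    then show ?thesis
      using int[of s] int'[of s] F0[of s] F0'[of s] by simp
  qed
  note R0 = this
  have "(\<integral>t. of_real (Im (f t)) * exp (\<i> * of_real (s * ln t)) \<partial>?L) = 0" for s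
  proof -
    have "(\<integral>t. of_real (Im (f t)) * exp (\<i> * of_real (s * ln t)) \<partial>?L) =
      (\<integral>t. (f t * exp (\<i> * of_real (s * ln t)) - cnj (f t) * exp (\<i> * of_real (s * ln t))) / (2 * \<i>) \<partial>?L)"
      unfolding im by (simp add: algebra_simps diff_divide_distrib)
    then show ?thesis
      using int[of s] int'[of s] F0[of s] F0'[of s] by simp
  qed
  note I0 = this
  have "AE t in ?L. r t = 0"
    if rm[measurable]: "r \<in> borel_measurable borel" and r: "integrable ?L r"
    and r0: "\<And>s. (\<integral>t. of_real (r t) * exp (\<i> * of_real (s * ln t)) \<partial>?L) = 0" for r :: "real \<Rightarrow> real"
  proof -
    have "AE t in ?L. r t \<le> 0"
      using rm r r0 by (rule AE_le_0_if_Mellin_eq_0)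
    moreover have "AE t in ?L. - r t \<le> 0"
      using r r0 by (intro AE_le_0_if_Mellin_eq_0) simp_all
    ultimately show ?thesis by eventually_elim simp
  qed
  note z = this
  have "AE t in ?L. Re (f t) = 0"
    by (rule z[OF _ integrable_Re[OF f] R0]) measurable
  moreover have "AE t in ?L. Im (f t) = 0"
    by (rule z[OF _ integrable_Im[OF f] I0]) measurable
  ultimately show ?thesis by eventually_elim (simp add: complex_eq_iff)
qed

text \<open>A bad point \<open>x\<close> of \<open>A\<close> equals \<open>g (h x)\<close> with
  \<open>h x\<close> bad in \<open>B\<close>, so the bad set lies in the image of a null set under
  the differentiable map \<open>g\<close>, which is again null.\<close>

lemma AE_lborel_compose:
  fixes g h :: "real \<Rightarrow> real"
  assumes ae: "AE x in lborel. x \<in> B \<longrightarrow> P x"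
    and g: "g differentiable_on B" and h: "\<And>x. x \<in> A \<Longrightarrow> h x \<in> B" "\<And>x. x \<in> A \<Longrightarrow> g (h x) = x"
  shows "AE x in lborel. x \<in> A \<longrightarrow> P (h x)"
proof -
  define S where "S = {x \<in> B. \<not> P x}"
  have "AE x in lebesgue. x \<in> B \<longrightarrow> P x"
    using ae by (rule AE_completion)
  then have "{x. \<not> (x \<in> B \<longrightarrow> P x)} \<in> null_sets lebesgue"
    unfolding completion.AE_iff_null_sets by simp
  then have "negligible S"
    by (simp add: negligible_iff_null_sets S_def)
  then have "negligible (g ` S)"
    by (rule negligible_differentiable_image_negligible[OF order_refl])
       (rule differentiable_on_subset[OF g], auto simp: S_def)
  moreover have "{x. \<not> (x \<in> A \<longrightarrow> P (h x))} \<subseteq> g ` S"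
  proof
    fix x assume "x \<in> {x. \<not> (x \<in> A \<longrightarrow> P (h x))}"
    then show "x \<in> g ` S"
      using h by (intro image_eqI[of _ _ "h x"]) (auto simp: S_def)
  qed
  ultimately have "{x. \<not> (x \<in> A \<longrightarrow> P (h x))} \<in> null_sets lebesgue"
    using negligible_subset negligible_iff_null_sets by blast
  then have "AE x in lebesgue. x \<in> A \<longrightarrow> P (h x)"
    unfolding completion.AE_iff_null_sets by simp
  then show ?thesis
    by (simp only: AE_completion_iff)
qed

text \<open>Substituting \<open>a = t * sqrt \<tau>\<close> turns the point of the curve into
  \<open>(a, a / \<tau>)\<close>. Fubini exchanges \<open>a\<close> and \<tau>, and for fixed
  \<open>a\<close> the substitution \<open>b = a / \<tau>\<close> finishes.\<close>

lemma AE_pairs_if_AE_ratio_curves: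
  fixes G :: "real \<Rightarrow> real \<Rightarrow> complex"
  assumes G[measurable]: "(\<lambda>(a, b). G a b) \<in> borel_measurable (borel \<Otimes>\<^sub>M borel)"
    and ae: "AE \<tau> in lborel. 0 < \<tau> \<longrightarrow> (AE t in lborel. 0 < t \<longrightarrow> G (t * sqrt \<tau>) (t / sqrt \<tau>) = 0)"
  shows "AE a in lborel. 0 < a \<longrightarrow> (AE b in lborel. 0 < b \<longrightarrow> G a b = 0)"
proof -
  have "AE \<tau> in lborel. AE a in lborel. 0 < \<tau> \<and> 0 < a \<longrightarrow> G a (a / \<tau>) = 0"
    using ae
  proof eventually_elim
    case (elim \<tau>)
    show ?case
    proof (cases "0 < \<tau>")
      case True
      have "AE a in lborel. a \<in> {0<..} \<longrightarrow> G ((a / sqrt \<tau>) * sqrt \<tau>) ((a / sqrt \<tau>) / sqrt \<tau>) = 0"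
      proof (rule AE_lborel_compose[where h="\<lambda>a. a / sqrt \<tau>" and g="\<lambda>t. t * sqrt \<tau>" and B="{0<..}"])
        show "AE t in lborel. t \<in> {0<..} \<longrightarrow> G (t * sqrt \<tau>) (t / sqrt \<tau>) = 0"
          using elim True by simp
      qed (use True in \<open>auto intro!: derivative_intros\<close>)
      then show ?thesis
        using True by eventually_elim (simp add: divide_divide_eq_left)
    qed simp
  qed
  then have "AE a in lborel. AE \<tau> in lborel. 0 < \<tau> \<and> 0 < a \<longrightarrow> G a (a / \<tau>) = 0"
    by (subst (asm) lborel_pair.AE_commute) measurable
  then show ?thesis
  proof eventually_elim
    case (elim a)
    show ?case
    proof
      assume a: "0 < a"
      have "AE b in lborel. b \<in> {0<..} \<longrightarrow> G a (a / (a / b)) = 0"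
      proof (rule AE_lborel_compose[where h="\<lambda>b. a / b" and g="\<lambda>\<tau>. a / \<tau>" and B="{0<..}"])
        show "AE \<tau> in lborel. \<tau> \<in> {0<..} \<longrightarrow> G a (a / \<tau>) = 0"
          using elim a by simp
        show "(\<lambda>\<tau>. a / \<tau>) differentiable_on {0<..}"
          by (auto simp: differentiable_on_def intro!: differentiable_divide differentiable_ident differentiable_const)
      qed (use a in auto)
      then show "AE b in lborel. 0 < b \<longrightarrow> G a b = 0"
        by eventually_elim (use a in auto)
    qed
  qed
qed

section \<open>The ambiguity function\<close>

lemma half_plane_in_lebesgue: "UNIV \<times> {0<..} \<in> sets (lebesgue :: (real \<times> real) measure)"
proof -
  have "open (UNIV \<times> {0<..} :: (real \<times> real) set)"
    by (intro open_Times) auto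
  then show ?thesis by (simp add: sets_completionI_sets)
qed

text \<open>Fubini for null sets, with the second coordinate outermost: for almost every \<tau> a
  property is to hold for almost every \<theta>.\<close>

lemma lborel_AE_swap:
  assumes "AE z in lebesgue :: (real \<times> real) measure. R (fst z) (snd z)"
  shows "AE y in lborel :: real measure. AE x in lborel. R x y"
proof -
  have "AE z in lborel \<Otimes>\<^sub>M lborel. R (fst z) (snd z)"
    using assms unfolding AE_completion_iff lborel_prod .
  then have "AE z in distr (lborel \<Otimes>\<^sub>M lborel) (lborel \<Otimes>\<^sub>M lborel) (\<lambda>(x, y). (y, x)). R (fst z) (snd z)"
    by (subst (asm) lborel_pair.distr_pair_swap)
  from AE_distrD[OF _ this]
  have "AE z in lborel \<Otimes>\<^sub>M lborel. R (snd z) (fst z)"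
    by (simp add: split_beta)
  from lborel_pair.AE_pair[OF this] show ?thesis by simp
qed

text \<open>A character in \<open>ln t\<close> of frequency \<open>- 2 * pi * \<theta>\<close>
  against the measure dt/t; this makes the ambiguity function a Fourier transform in
  \<theta>.\<close>

lemma ambiguity_kernel:
  assumes "0 < t"
  shows "of_real t powr (- (\<i> * 2 * of_real pi * of_real \<theta>) - 1)
    = exp (\<i> * of_real ((- 2 * pi * \<theta>) * ln t)) / of_real t"
proof -
  have "of_real t powr (- (\<i> * 2 * of_real pi * of_real \<theta>) - 1)
      = of_real t powr (- (\<i> * 2 * of_real pi * of_real \<theta>)) / (of_real t powr 1 :: complex)"
    by (rule powr_diff)
  also have "\<dots> = exp (\<i> * of_real ((- 2 * pi * \<theta>) * ln t)) / of_real t"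
    using assms by (simp add: powr_def Ln_of_real exp_of_real algebra_simps)
  finally show ?thesis .
qed

locale ambiguity_process = prob_space M for M :: "'a measure" +
  fixes X :: "real \<Rightarrow> 'a \<Rightarrow> complex"
  assumes measurable_X: "measurable_process M X"
    and ambiguity_exists: "\<And>\<theta> \<tau>. \<tau> > 0 \<Longrightarrow> ms_integrable M (lebesgue_on {0<..}) (ambiguity_integrand X \<theta> \<tau>)"
begin

lemma has_ms_integral_ambiguity:
  "0 < \<tau> \<Longrightarrow> has_ms_integral M (lebesgue_on {0<..}) (ambiguity_integrand X \<theta> \<tau>) (ambiguity M X \<theta> \<tau>)"
  unfolding ambiguity_def by (rule has_ms_integral_ms_integral[OF ambiguity_exists])

lemma square_integrable_ambiguity: "0 < \<tau> \<Longrightarrow> square_integrable M (ambiguity M X \<theta> \<tau>)"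
  using has_ms_integral_ambiguity by (simp add: has_ms_integral_def)

lemma measurable_X_restrict: "(\<lambda>(t, \<omega>). X t \<omega>) \<in> borel_measurable (restrict_space lborel {0<..} \<Otimes>\<^sub>M M)"
proof -
  have "sets (restrict_space lborel {0<..} \<Otimes>\<^sub>M M) = sets (restrict_space borel {0<..} \<Otimes>\<^sub>M M)"
    by (intro sets_pair_measure_cong) (simp_all add: sets_restrict_space)
  then show ?thesis
    using measurable_X measurable_cong_sets[OF _ refl] unfolding measurable_process_def by blast
qed

text \<open>For \<theta> = 0 and \<tau> = 1 the integrand at time \<open>a\<close> is the squared
  modulus of \<open>X a\<close> divided by \<open>a\<close>, and mean-square integrands are
  second-order at every point.\<close>

lemma integrable_X_power4:
  assumes a: "0 < a"
  shows "integrable M (\<lambda>\<omega>. cmod (X a \<omega>) ^ 4)"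
proof -
  have "square_integrable M (ambiguity_integrand X 0 1 a)"
    using has_ms_integral_ambiguity[of 1 0] a by (simp add: has_ms_integral_def)
  then have "integrable M (\<lambda>\<omega>. (cmod (ambiguity_integrand X 0 1 a \<omega>))\<^sup>2)"
    by (rule square_integrableD)
  moreover have "(cmod (ambiguity_integrand X 0 1 a \<omega>))\<^sup>2 = cmod (X a \<omega>) ^ 4 * (1 / a)\<^sup>2" for \<omega>
  proof -
    have "ambiguity_integrand X 0 1 a \<omega> = X a \<omega> * cnj (X a \<omega>) / of_real a"
      unfolding ambiguity_integrand_def ambiguity_kernel[OF a] by simp
    then show ?thesis
      by (simp add: norm_mult norm_divide power_divide power_mult_distrib flip: power_add)
  qed
  ultimately have "integrable M (\<lambda>\<omega>. cmod (X a \<omega>) ^ 4 * (1 / a)\<^sup>2)" by simp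
  then show ?thesis
    using a by (subst (asm) integrable_mult_right_iff) simp
qed

text \<open>The time argument is clamped to the positive half-line to get a total function.\<close>

definition triple :: "('a \<Rightarrow> complex) \<Rightarrow> real \<Rightarrow> real \<Rightarrow> complex" where
  "triple e a b = ms_inner M (\<lambda>\<omega>. X (if 0 < a then a else 1) \<omega> * cnj (X (if 0 < b then b else 1) \<omega>)) e"

lemma triple_eq: "0 < a \<Longrightarrow> 0 < b \<Longrightarrow> triple e a b = ms_inner M (\<lambda>\<omega>. X a \<omega> * cnj (X b \<omega>)) e"
  by (simp add: triple_def)

text \<open>Joint measurability of \<open>X\<close> makes the parameter integral measurable in both
  times; Fubini and the uniqueness of the transform rely on this.\<close>

lemma measurable_triple:
  assumes e: "square_integrable M e"
  shows "(\<lambda>(a, b). triple e a b) \<in> borel_measurable (borel \<Otimes>\<^sub>M borel)"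
proof -
  note [measurable] = square_integrableD(1)[OF e]
  have clamp: "(\<lambda>(t, \<omega>). X (if 0 < t then t else 1) \<omega>) \<in> borel_measurable (borel \<Otimes>\<^sub>M M)"
  proof -
    have "(\<lambda>t::real. if 0 < t then t else 1) \<in> borel \<rightarrow>\<^sub>M restrict_space borel {0<..}"
      by (rule measurable_restrict_space2) auto
    then have "(\<lambda>p. ((\<lambda>t::real. if 0 < t then t else 1) (fst p), snd p)) \<in> borel \<Otimes>\<^sub>M M \<rightarrow>\<^sub>M restrict_space borel {0<..} \<Otimes>\<^sub>M M"
      by measurable
    from measurable_compose[OF this measurable_X[unfolded measurable_process_def]]
    show ?thesis by (simp add: split_beta)
  qed
  have [measurable]: "(\<lambda>p. X (if 0 < f (fst p) then f (fst p) else 1) (snd p)) \<in> borel_measurable ((borel \<Otimes>\<^sub>M borel) \<Otimes>\<^sub>M M)"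
    if [measurable]: "f \<in> borel_measurable (borel \<Otimes>\<^sub>M borel)" for f :: "real \<times> real \<Rightarrow> real"
  proof -
    have "(\<lambda>p. (f (fst p), snd p)) \<in> (borel \<Otimes>\<^sub>M borel) \<Otimes>\<^sub>M M \<rightarrow>\<^sub>M borel \<Otimes>\<^sub>M M" by measurable
    from measurable_compose[OF this clamp] show ?thesis by simp
  qed
  have "(\<lambda>p. triple e (fst p) (snd p)) \<in> borel_measurable (borel \<Otimes>\<^sub>M borel)"
    unfolding triple_def ms_inner_def
    by (rule borel_measurable_lebesgue_integral) (simp add: split_beta)
  then show ?thesis by (simp add: split_beta)
qed

lemma ms_inner_ambiguity:
  assumes e: "square_integrable M e" and \<tau>: "0 < \<tau>"
  shows "has_bochner_integral (lebesgue_on {0<..})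
    (\<lambda>t. triple e (t * sqrt \<tau>) (t / sqrt \<tau>) / of_real t * exp (\<i> * of_real ((- 2 * pi * \<theta>) * ln t)))
    (ms_inner M (ambiguity M X \<theta> \<tau>) e)"
proof -
  have "has_bochner_integral (lebesgue_on {0<..}) (\<lambda>t. ms_inner M (ambiguity_integrand X \<theta> \<tau> t) e)
    (ms_inner M (ambiguity M X \<theta> \<tau>) e)"
    by (rule has_ms_integral_ms_inner[OF complete_measure_lebesgue_on has_ms_integral_ambiguity[OF \<tau>] e]) simp
  also have "?this \<longleftrightarrow> ?thesis"
  proof (rule has_bochner_integral_cong)
    fix t assume "t \<in> space (lebesgue_on {0<..} :: real measure)"
    then have t: "0 < t" by simp
    have "ambiguity_integrand X \<theta> \<tau> t =
      (\<lambda>\<omega>. (exp (\<i> * of_real ((- 2 * pi * \<theta>) * ln t)) / of_real t) * (X (t * sqrt \<tau>) \<omega> * cnj (X (t / sqrt \<tau>) \<omega>)))"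
      unfolding ambiguity_integrand_def ambiguity_kernel[OF t] by (simp add: mult.commute)
    then show "ms_inner M (ambiguity_integrand X \<theta> \<tau> t) e =
      triple e (t * sqrt \<tau>) (t / sqrt \<tau>) / of_real t * exp (\<i> * of_real ((- 2 * pi * \<theta>) * ln t))"
      using t \<tau> by (simp only: ms_inner_cmult_left) (simp add: triple_eq)
  qed simp_all
  finally show ?thesis .
qed

text \<open>Dominated convergence: the characters have modulus 1, so the modulus of \<open>g\<close>
  dominates, and it is integrable by the case \<theta> = 0.\<close>

lemma continuous_ms_inner_ambiguity:
  assumes e: "square_integrable M e" and \<tau>: "0 < \<tau>"
  shows "continuous_on UNIV (\<lambda>\<theta>. ms_inner M (ambiguity M X \<theta> \<tau>) e)"
proof -
  define g where "g t = triple e (t * sqrt \<tau>) (t / sqrt \<tau>) / of_real t" for t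
  note h = ms_inner_ambiguity[OF e \<tau>, folded g_def]
  have hi: "integrable (lebesgue_on {0<..}) (\<lambda>t. g t * exp (\<i> * of_real ((- 2 * pi * \<theta>) * ln t)))"
    and h_eq: "ms_inner M (ambiguity M X \<theta> \<tau>) e
      = (\<integral>t. g t * exp (\<i> * of_real ((- 2 * pi * \<theta>) * ln t)) \<partial>lebesgue_on {0<..})" for \<theta>
    using h[of \<theta>] by (simp_all only: has_bochner_integral_iff)
  have g: "integrable (lebesgue_on {0<..}) g"
    using hi[of 0] by simp
  have "((\<lambda>n. ms_inner M (ambiguity M X (u n) \<tau>) e) \<longlonglongrightarrow> ms_inner M (ambiguity M X \<theta> \<tau>) e)"
    if u: "u \<longlonglongrightarrow> \<theta>" for u \<theta>
  proof -
    have "(\<lambda>n. \<integral>t. g t * exp (\<i> * of_real ((- 2 * pi * u n) * ln t)) \<partial>lebesgue_on {0<..})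
      \<longlonglongrightarrow> (\<integral>t. g t * exp (\<i> * of_real ((- 2 * pi * \<theta>) * ln t)) \<partial>lebesgue_on {0<..})"
    proof (rule integral_dominated_convergence[where w="\<lambda>t. norm (g t)"])
      show "AE t in lebesgue_on {0<..}. (\<lambda>n. g t * exp (\<i> * of_real ((- 2 * pi * u n) * ln t)))
          \<longlonglongrightarrow> g t * exp (\<i> * of_real ((- 2 * pi * \<theta>) * ln t))"
        by (intro AE_I2 tendsto_intros u)
      show "AE t in lebesgue_on {0<..}. norm (g t * exp (\<i> * of_real ((- 2 * pi * u n) * ln t))) \<le> norm (g t)" for n
        by (simp add: norm_mult)
    qed (use g in \<open>simp_all only: borel_measurable_integrable[OF hi] integrable_norm\<close>)
    then show ?thesis
      unfolding h_eq .
  qed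
  then show ?thesis
    unfolding continuous_on_sequentially by (auto simp: o_def)
qed

text \<open>Continuity takes care of \<theta>, but the exceptional null set of \<tau> can only be
  removed through the moments E[X(a) X*(b) e*], which do not see \<tau>.\<close>

proposition ambiguity_orthogonal_everywhere:
  assumes e: "square_integrable M e"
    and ae: "AE z in half_plane. ms_inner M (ambiguity M X (fst z) (snd z)) e = 0"
    and \<tau>: "0 < \<tau>"
  shows "ms_inner M (ambiguity M X \<theta> \<tau>) e = 0"
proof -
  let ?L = "lebesgue_on {0<..} :: real measure"
  define h where "h \<theta> \<tau> = ms_inner M (ambiguity M X \<theta> \<tau>) e" for \<theta> \<tau>
  have L: "(AE t in ?L. P t) \<longleftrightarrow> (AE t in lborel. 0 < t \<longrightarrow> P t)" for P
    by (subst AE_restrict_space_iff) (simp_all add: AE_completion_iff)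
  have "AE z in lebesgue. 0 < snd z \<longrightarrow> h (fst z) (snd z) = 0"
    using ae by (subst (asm) AE_restrict_space_iff) (auto simp: h_def mem_Times_iff half_plane_in_lebesgue)
  from lborel_AE_swap[OF this]
  have "AE \<tau> in lborel. AE \<theta> in lborel. 0 < \<tau> \<longrightarrow> h \<theta> \<tau> = 0" .
  then have curves: "AE \<tau> in lborel. 0 < \<tau> \<longrightarrow>
    (AE t in lborel. 0 < t \<longrightarrow> triple e (t * sqrt \<tau>) (t / sqrt \<tau>) = 0)"
  proof eventually_elim
    case (elim \<tau>)
    show ?case
    proof
      assume \<tau>: "0 < \<tau>"
      then have "AE \<theta> in lebesgue. h \<theta> \<tau> = 0"
        using elim by (simp add: AE_completion_iff)
      then have "{\<theta>. h \<theta> \<tau> \<noteq> 0} \<in> null_sets lebesgue"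
        unfolding completion.AE_iff_null_sets by simp
      then have "negligible {\<theta>. h \<theta> \<tau> \<noteq> 0}"
        by (simp add: negligible_iff_null_sets)
      \<comment> \<open>An open negligible set is empty, so \<open>h\<close> vanishes for every
        \<theta>.\<close>
      moreover have "open {\<theta>. h \<theta> \<tau> \<noteq> 0}"
        using continuous_ms_inner_ambiguity[OF e \<tau>] unfolding h_def
        by (intro open_Collect_neq continuous_on_const)
      ultimately have h0: "h \<theta> \<tau> = 0" for \<theta>
        using open_not_negligible by blast
      note I = ms_inner_ambiguity[OF e \<tau>]
      have "AE t in ?L. triple e (t * sqrt \<tau>) (t / sqrt \<tau>) / of_real t = 0"
      proof (rule AE_eq_0_if_Mellin_eq_0)
        have "(\<lambda>t. (t * sqrt \<tau>, t / sqrt \<tau>)) \<in> borel \<rightarrow>\<^sub>M borel \<Otimes>\<^sub>M borel" by measurable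
        from measurable_compose[OF this measurable_triple[OF e]]
        show "(\<lambda>t. triple e (t * sqrt \<tau>) (t / sqrt \<tau>) / of_real t) \<in> borel_measurable borel"
          by (intro borel_measurable_divide) simp_all
        show "integrable ?L (\<lambda>t. triple e (t * sqrt \<tau>) (t / sqrt \<tau>) / of_real t)"
          using I[of 0] by (simp add: has_bochner_integral_iff)
        \<comment> \<open>Frequency \<open>s\<close> corresponds to
          \<open>\<theta> = - s / (2 * pi)\<close>.\<close>
        show "(\<integral>t. triple e (t * sqrt \<tau>) (t / sqrt \<tau>) / of_real t * exp (\<i> * of_real (s * ln t)) \<partial>?L) = 0" for s
          using has_bochner_integral_integral_eq[OF I[of "- s / (2 * pi)"]] h0[of "- s / (2 * pi)"]
          by (simp add: h_def)
      qed
      then show "AE t in lborel. 0 < t \<longrightarrow> triple e (t * sqrt \<tau>) (t / sqrt \<tau>) = 0"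
        unfolding L by eventually_elim auto
    qed
  qed
  let ?N = "restrict_space lborel {0<..} :: real measure"
  have N: "(AE t in ?N. P t) \<longleftrightarrow> (AE t in lborel. 0 < t \<longrightarrow> P t)" for P
    by (subst AE_restrict_space_iff) simp_all
  have pairs: "AE a in ?N. AE b in ?N. ms_inner M (\<lambda>\<omega>. X a \<omega> * cnj (X b \<omega>)) e = 0"
    unfolding N using AE_pairs_if_AE_ratio_curves[OF measurable_triple[OF e] curves]
  proof eventually_elim
    case (elim a)
    show ?case
    proof
      assume a: "0 < a"
      with elim have "AE b in lborel. 0 < b \<longrightarrow> triple e a b = 0" by simp
      then show "AE b in lborel. 0 < b \<longrightarrow> ms_inner M (\<lambda>\<omega>. X a \<omega> * cnj (X b \<omega>)) e = 0"
        by eventually_elim (use a in \<open>auto simp: triple_eq\<close>)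
    qed
  qed
  \<comment> \<open>The curve for a single \<tau> is a null set of the plane, so the statement on
    almost all pairs says nothing about it; separate conditions on \<open>a\<close> and
    \<open>b\<close> do.\<close>
  obtain P Q where PQ: "AE a in ?N. P a" "AE b in ?N. Q b"
    "\<And>a b. a \<in> space ?N \<Longrightarrow> b \<in> space ?N \<Longrightarrow> P a \<Longrightarrow> Q b \<Longrightarrow> ms_inner M (\<lambda>\<omega>. X a \<omega> * cnj (X b \<omega>)) e = 0"
    using AE_pairs_imp_AE_separately[OF measurable_X_restrict _ e] pairs integrable_X_power4
    by (auto simp: space_restrict_space)
  have lin: "(\<lambda>a::real. a * c) differentiable_on {0<..}" for c
    by (auto intro!: derivative_intros)
  \<comment> \<open>Each coordinate of the curve is an invertible linear function of
    \<open>t\<close>, so it pulls null sets back to null sets.\<close>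
  have "AE t in lborel. t \<in> {0<..} \<longrightarrow> P (t * sqrt \<tau>)"
    by (rule AE_lborel_compose[OF _ lin[of "1 / sqrt \<tau>"]]) (use PQ(1) \<tau> in \<open>auto simp: N\<close>)
  moreover have "AE t in lborel. t \<in> {0<..} \<longrightarrow> Q (t / sqrt \<tau>)"
    by (rule AE_lborel_compose[OF _ lin[of "sqrt \<tau>"]]) (use PQ(2) \<tau> in \<open>auto simp: N\<close>)
  ultimately have "AE t in lborel. 0 < t \<longrightarrow> triple e (t * sqrt \<tau>) (t / sqrt \<tau>) = 0"
  proof eventually_elim
    case (elim t)
    show ?case
    proof
      assume "0 < t"
      then show "triple e (t * sqrt \<tau>) (t / sqrt \<tau>) = 0"
        using elim PQ(3)[of "t * sqrt \<tau>" "t / sqrt \<tau>"] \<tau> by (simp add: triple_eq space_restrict_space)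
    qed
  qed
  then have "AE t in ?L. triple e (t * sqrt \<tau>) (t / sqrt \<tau>) / of_real t * exp (\<i> * of_real ((- 2 * pi * \<theta>) * ln t)) = 0"
    unfolding L by eventually_elim auto
  then have "(\<integral>t. triple e (t * sqrt \<tau>) (t / sqrt \<tau>) / of_real t * exp (\<i> * of_real ((- 2 * pi * \<theta>) * ln t)) \<partial>?L) = 0"
    by (rule integral_eq_zero_AE)
  then show ?thesis
    using has_bochner_integral_integral_eq[OF ms_inner_ambiguity[OF e \<tau>]] by simp
qed

end

section \<open>Optimal estimators\<close>

lemma ms_error_eq: "ms_error M w Y = (ms_norm M (\<lambda>\<omega>. Y \<omega> - w))\<^sup>2"
  by (simp add: ms_error_def ms_norm_sq)

section \<open>Minimality and orthogonality in mean square\<close>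

lemma ms_norm_cong_AE:
  assumes [measurable]: "f \<in> borel_measurable M" "g \<in> borel_measurable M"
    and "AE x in M. f x = g x"
  shows "ms_norm M f = ms_norm M g"
proof -
  have "(\<integral>x. (cmod (f x))\<^sup>2 \<partial>M) = (\<integral>x. (cmod (g x))\<^sup>2 \<partial>M)"
    using assms(3) by (intro integral_cong_AE) auto
  then show ?thesis by (simp add: ms_norm_def)
qed

lemma AE_eq_0_if_ms_inner_self_eq_0:
  assumes f: "square_integrable M f" and z: "ms_inner M f f = 0"
  shows "AE x in M. f x = 0"
proof -
  have "(\<integral>x. (cmod (f x))\<^sup>2 \<partial>M) = 0"
    using z by (simp add: ms_inner_self ms_norm_sq flip: of_real_power)
  then have "AE x in M. (cmod (f x))\<^sup>2 = 0"
    using integral_nonneg_eq_0_iff_AE[OF square_integrableD(2)[OF f]] by simp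
  then show ?thesis by eventually_elim simp
qed

lemma ms_norm_add_cmult_sq:
  assumes e: "square_integrable M e" and p: "square_integrable M p"
  shows "(ms_norm M (\<lambda>x. e x + c * p x))\<^sup>2
    = (ms_norm M e)\<^sup>2 + (cmod c)\<^sup>2 * (ms_norm M p)\<^sup>2 + 2 * Re (c * ms_inner M p e)"
proof -
  have "(ms_norm M (\<lambda>x. c * p x))\<^sup>2 = (cmod c)\<^sup>2 * (ms_norm M p)\<^sup>2"
    by (simp add: ms_norm_sq norm_mult power_mult_distrib)
  then show ?thesis
    using ms_norm_add_sq[OF e square_integrable_cmult[OF p, of c]] by (simp only: ms_inner_cmult_left)
qed

text \<open>If the inner product were nonzero, a step from \<open>e\<close> along \<open>p\<close>
  against its phase would shorten \<open>e\<close>.\<close>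

lemma ms_inner_eq_0_if_minimal:
  assumes e: "square_integrable M e" and p: "square_integrable M p"
    and min: "\<And>c. ms_norm M e \<le> ms_norm M (\<lambda>x. e x + c * p x)"
  shows "ms_inner M p e = 0"
proof (rule ccontr)
  define z where "z = ms_inner M p e"
  \<comment> \<open>The best step length divides by the squared norm of \<open>p\<close>. The
    \<open>+ 1\<close> also covers norm 0 and keeps the quadratic term below the linear one.\<close>
  define s where "s = 1 / ((ms_norm M p)\<^sup>2 + 1)"
  assume "ms_inner M p e \<noteq> 0"
  then have z: "0 < (cmod z)\<^sup>2" by (simp add: z_def)
  have np: "0 < (ms_norm M p)\<^sup>2 + 1" by (intro add_nonneg_pos) auto
  then have s: "0 < s" by (simp add: s_def)
  define c where "c = - (of_real s * cnj z)"
  have "c * z = - of_real (s * (cmod z)\<^sup>2)"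
    unfolding of_real_mult complex_norm_square by (simp add: c_def mult_ac)
  then have cz: "Re (c * z) = - (s * (cmod z)\<^sup>2)" by simp
  have cc: "(cmod c)\<^sup>2 = s\<^sup>2 * (cmod z)\<^sup>2" by (simp add: c_def norm_mult power_mult_distrib)
  have "(ms_norm M e)\<^sup>2 \<le> (ms_norm M (\<lambda>x. e x + c * p x))\<^sup>2"
    by (rule power_mono[OF min ms_norm_nonneg])
  then have "0 \<le> s\<^sup>2 * (cmod z)\<^sup>2 * (ms_norm M p)\<^sup>2 - 2 * (s * (cmod z)\<^sup>2)"
    unfolding ms_norm_add_cmult_sq[OF e p] z_def[symmetric] cz cc by simp
  also have "\<dots> = (s * (cmod z)\<^sup>2) * (s * (ms_norm M p)\<^sup>2 - 2)"
    by (simp add: algebra_simps power2_eq_square)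
  also have "\<dots> < 0"
  proof (rule mult_pos_neg)
    have "s * (ms_norm M p)\<^sup>2 \<le> 1" using np by (simp add: s_def field_simps)
    then show "s * (ms_norm M p)\<^sup>2 - 2 < 0" by simp
  qed (use s z in simp)
  finally show False by simp
qed

lemma phase_nonzero: "0 < t \<Longrightarrow> 0 < \<tau> \<Longrightarrow> phase t \<xi> \<theta> \<tau> \<noteq> 0"
  by (simp add: phase_def)

lemma sigma_finite_measure_completion:
  assumes "sigma_finite_measure M"
  shows "sigma_finite_measure (completion M)"
proof -
  interpret sigma_finite_measure M by fact
  obtain A where A: "countable A" "A \<subseteq> sets M" "\<Union>A = space M" "\<forall>a\<in>A. emeasure M a \<noteq> \<infinity>"
    using sigma_finite_countable by blast
  have "emeasure (completion M) a = emeasure M a" if "a \<in> A" for a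
    using A(2) that by (subst emeasure_completion) (auto simp: main_part_sets intro: sets_completionI_sets)
  then show ?thesis
    using A by (intro sigma_finite_measure.intro exI[of _ A]) (auto intro: sets_completionI_sets)
qed

text \<open>Sigma-finiteness provides a strictly positive integrable function; its square root is a
  test kernel without zeros.\<close>

lemma positive_square_integrable_half_plane:
  obtains \<psi>0 :: "real \<times> real \<Rightarrow> complex" where "square_integrable half_plane \<psi>0"
    "\<And>z. z \<in> space half_plane \<Longrightarrow> \<psi>0 z \<noteq> 0"
proof -
  interpret sigma_finite_measure half_plane
    by (rule sigma_finite_measure_restrict_space[OF _ half_plane_in_lebesgue])
       (rule sigma_finite_measure_completion[OF sigma_finite_lborel])
  obtain h where h[measurable]: "h \<in> borel_measurable half_plane" and fin: "integral\<^sup>N half_plane h \<noteq> \<infinity>"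
    and pos: "\<And>z. z \<in> space half_plane \<Longrightarrow> 0 < h z \<and> h z < \<infinity>"
    using Ex_finite_integrable_function by blast
  define \<psi>0 where "\<psi>0 z = complex_of_real (sqrt (enn2real (h z)))" for z
  show thesis
  proof (rule that)
    have eq: "(cmod (\<psi>0 z))\<^sup>2 = enn2real (h z)" for z
      by (simp add: \<psi>0_def)
    have "integrable half_plane (\<lambda>z. enn2real (h z))"
    proof (rule integrableI_nonneg)
      have "(\<integral>\<^sup>+z. ennreal (enn2real (h z)) \<partial>half_plane) = integral\<^sup>N half_plane h"
        using pos by (intro nn_integral_cong) auto
      then show "(\<integral>\<^sup>+z. ennreal (enn2real (h z)) \<partial>half_plane) < \<infinity>"
        using fin by (simp add: less_top)
    qed auto
    then show "square_integrable half_plane \<psi>0"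
      unfolding square_integrable_def eq by (simp add: \<psi>0_def[abs_def])
    show "\<psi>0 z \<noteq> 0" if "z \<in> space half_plane" for z
      using pos[OF that] by (auto simp: \<psi>0_def enn2real_eq_0_iff)
  qed
qed

section \<open>Estimators as functions of the kernel\<close>

locale estimator_process = ambiguity_process +
  assumes estimator_exists: "\<And>\<phi> t \<xi>. square_integrable half_plane \<phi> \<Longrightarrow> t > 0 \<Longrightarrow>
    ms_integrable M half_plane (estimator_integrand M X \<phi> t \<xi>)"
begin

context
  fixes t \<xi> :: real
  assumes t: "0 < t"
begin

abbreviation "est \<phi> \<equiv> estimator M X \<phi> t \<xi>"

lemma has_ms_integral_estimator:
  "square_integrable half_plane \<phi> \<Longrightarrow> has_ms_integral M half_plane (estimator_integrand M X \<phi> t \<xi>) (est \<phi>)"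
  unfolding estimator_def by (rule has_ms_integral_ms_integral[OF estimator_exists[OF _ t]])

lemma square_integrable_estimator:
  "square_integrable half_plane \<phi> \<Longrightarrow> square_integrable M (est \<phi>)"
  using has_ms_integral_estimator by (simp add: has_ms_integral_def)

text \<open>Kernel and phase are deterministic and leave the pairing as scalars, so the pairing is
  an integral linear in the kernel.\<close>

lemma ms_inner_estimator:
  assumes \<phi>: "square_integrable half_plane \<phi>" and e: "square_integrable M e"
  shows "has_bochner_integral half_plane
    (\<lambda>z. ms_inner M (ambiguity M X (fst z) (snd z)) e * \<phi> z * phase t \<xi> (fst z) (snd z)) (ms_inner M (est \<phi>) e)"
proof -
  have "ms_inner M (estimator_integrand M X \<phi> t \<xi> z) e =
    ms_inner M (ambiguity M X (fst z) (snd z)) e * \<phi> z * phase t \<xi> (fst z) (snd z)" for z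
  proof -
    have "estimator_integrand M X \<phi> t \<xi> z =
      (\<lambda>\<omega>. (\<phi> z * phase t \<xi> (fst z) (snd z)) * ambiguity M X (fst z) (snd z) \<omega>)"
      by (simp add: estimator_integrand_def split_beta mult_ac)
    then show ?thesis by (simp add: ms_inner_cmult_left mult_ac)
  qed
  then show ?thesis
    using has_ms_integral_ms_inner[OF complete_measure_lebesgue_on[OF half_plane_in_lebesgue] has_ms_integral_estimator[OF \<phi>] e]
    by simp
qed

text \<open>Estimators are chosen representatives, so linearity holds only almost surely. The defect
  \<open>D\<close> is orthogonal to itself by linearity of the pairing in the kernel.\<close>

lemma estimator_linear:
  assumes \<phi>: "square_integrable half_plane \<phi>" and \<psi>: "square_integrable half_plane \<psi>"
  shows "AE \<omega> in M. est (\<lambda>z. \<phi> z + c * \<psi> z) \<omega> = est \<phi> \<omega> + c * est \<psi> \<omega>"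
proof -
  let ?s = "\<lambda>z. \<phi> z + c * \<psi> z"
  have s: "square_integrable half_plane ?s"
    by (intro square_integrable_add square_integrable_cmult \<phi> \<psi>)
  note sq = square_integrable_estimator[OF s] square_integrable_estimator[OF \<phi>]
    square_integrable_cmult[OF square_integrable_estimator[OF \<psi>], of c]
  define D where "D \<omega> = est ?s \<omega> - (est \<phi> \<omega> + c * est \<psi> \<omega>)" for \<omega>
  have D: "square_integrable M D"
    unfolding D_def[abs_def] by (intro square_integrable_diff square_integrable_add sq)
  have "ms_inner M (est ?s) D = ms_inner M (est \<phi>) D + c * ms_inner M (est \<psi>) D"
  proof -
    have "has_bochner_integral half_plane
      (\<lambda>z. ms_inner M (ambiguity M X (fst z) (snd z)) D * \<phi> z * phase t \<xi> (fst z) (snd z)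
        + c * (ms_inner M (ambiguity M X (fst z) (snd z)) D * \<psi> z * phase t \<xi> (fst z) (snd z)))
      (ms_inner M (est \<phi>) D + c * ms_inner M (est \<psi>) D)"
      by (intro has_bochner_integral_add has_bochner_integral_mult_right ms_inner_estimator \<phi> \<psi> D)
    moreover have "ms_inner M (ambiguity M X (fst z) (snd z)) D * ?s z * phase t \<xi> (fst z) (snd z) =
       ms_inner M (ambiguity M X (fst z) (snd z)) D * \<phi> z * phase t \<xi> (fst z) (snd z)
        + c * (ms_inner M (ambiguity M X (fst z) (snd z)) D * \<psi> z * phase t \<xi> (fst z) (snd z))" for z
      by (simp add: algebra_simps)
    ultimately show ?thesis
      using has_bochner_integral_eq[OF ms_inner_estimator[OF s D]] by simp
  qed
  then have "ms_inner M D D = 0"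
    unfolding D_def[abs_def]
    by (subst ms_inner_diff_left[OF sq(1) square_integrable_add[OF sq(2,3)] D[unfolded D_def[abs_def]]],
        subst ms_inner_add_left[OF sq(2,3) D[unfolded D_def[abs_def]]]) (simp add: ms_inner_cmult_left)
  from AE_eq_0_if_ms_inner_self_eq_0[OF D this] show ?thesis
    by eventually_elim (simp add: D_def)
qed

text \<open>Perturbing the kernel by \<open>c * \<psi>\<close> perturbs the error variable by
  \<open>c * est \<psi>\<close>, so minimality forces orthogonality. Conversely, Pythagoras for the
  difference of two kernels shows that the error cannot decrease.\<close>

lemma locally_optimal_iff:
  assumes \<phi>: "square_integrable half_plane \<phi>"
  shows "locally_optimal M X t \<xi> \<phi> \<longleftrightarrow> (\<forall>\<psi>. square_integrable half_plane \<psi> \<longrightarrow>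
    ms_inner M (est \<psi>) (\<lambda>\<omega>. est \<phi> \<omega> - wigner_spectrum M X t \<xi>) = 0)"
proof -
  define W where "W = wigner_spectrum M X t \<xi>"
  define e where "e = (\<lambda>\<omega>. est \<phi> \<omega> - W)"
  have e: "square_integrable M e"
    unfolding e_def by (intro square_integrable_diff square_integrable_estimator \<phi> square_integrable_const prob_space_axioms)
  have err: "kernel_error M X t \<xi> (\<lambda>z. \<phi> z + c * \<psi> z) = (ms_norm M (\<lambda>\<omega>. e \<omega> + c * est \<psi> \<omega>))\<^sup>2"
    if \<psi>: "square_integrable half_plane \<psi>" for \<psi> c
  proof -
    have s: "square_integrable half_plane (\<lambda>z. \<phi> z + c * \<psi> z)"
      by (intro square_integrable_add square_integrable_cmult \<phi> \<psi>)
    note [measurable] = square_integrableD(1)[OF square_integrable_estimator[OF s]] square_integrableD(1)[OF e]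
      square_integrableD(1)[OF square_integrable_estimator[OF \<psi>]]
    have "ms_norm M (\<lambda>\<omega>. est (\<lambda>z. \<phi> z + c * \<psi> z) \<omega> - W) = ms_norm M (\<lambda>\<omega>. e \<omega> + c * est \<psi> \<omega>)"
    proof (rule ms_norm_cong_AE)
      show "AE \<omega> in M. est (\<lambda>z. \<phi> z + c * \<psi> z) \<omega> - W = e \<omega> + c * est \<psi> \<omega>"
        using estimator_linear[OF \<phi> \<psi>, of c] by eventually_elim (simp add: e_def)
    qed measurable
    then show ?thesis by (simp add: kernel_error_def ms_error_eq W_def)
  qed
  have err0: "kernel_error M X t \<xi> \<phi> = (ms_norm M e)\<^sup>2"
    by (simp add: kernel_error_def ms_error_eq W_def e_def)
  show ?thesis
    unfolding W_def[symmetric] e_def[symmetric]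
  proof
    assume opt: "locally_optimal M X t \<xi> \<phi>"
    show "\<forall>\<psi>. square_integrable half_plane \<psi> \<longrightarrow> ms_inner M (est \<psi>) e = 0"
    proof (intro allI impI)
      fix \<psi> assume \<psi>: "square_integrable half_plane \<psi>"
      show "ms_inner M (est \<psi>) e = 0"
      proof (rule ms_inner_eq_0_if_minimal[OF e square_integrable_estimator[OF \<psi>]])
        fix c
        have "square_integrable half_plane (\<lambda>z. \<phi> z + c * \<psi> z)"
          by (intro square_integrable_add square_integrable_cmult \<phi> \<psi>)
        then have "(ms_norm M e)\<^sup>2 \<le> (ms_norm M (\<lambda>\<omega>. e \<omega> + c * est \<psi> \<omega>))\<^sup>2"
          using opt unfolding locally_optimal_def err[OF \<psi>, symmetric] err0[symmetric] by blast
        then show "ms_norm M e \<le> ms_norm M (\<lambda>\<omega>. e \<omega> + c * est \<psi> \<omega>)"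
          by (rule power2_le_imp_le[OF _ ms_norm_nonneg])
      qed
    qed
  next
    assume orth: "\<forall>\<psi>. square_integrable half_plane \<psi> \<longrightarrow> ms_inner M (est \<psi>) e = 0"
    show "locally_optimal M X t \<xi> \<phi>"
      unfolding locally_optimal_def
    proof (intro conjI allI impI \<phi>)
      fix \<psi> assume \<psi>: "square_integrable half_plane \<psi>"
      define \<eta> where "\<eta> z = \<psi> z - \<phi> z" for z
      have \<eta>: "square_integrable half_plane \<eta>"
        unfolding \<eta>_def[abs_def] by (intro square_integrable_diff \<psi> \<phi>)
      have "kernel_error M X t \<xi> \<psi> = (ms_norm M (\<lambda>\<omega>. e \<omega> + 1 * est \<eta> \<omega>))\<^sup>2"
        using err[OF \<eta>, of 1] by (simp add: \<eta>_def)
      also have "\<dots> = (ms_norm M e)\<^sup>2 + (ms_norm M (est \<eta>))\<^sup>2"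
        unfolding ms_norm_add_cmult_sq[OF e square_integrable_estimator[OF \<eta>]] using orth \<eta> by simp
      finally show "kernel_error M X t \<xi> \<phi> \<le> kernel_error M X t \<xi> \<psi>"
        unfolding err0 by simp
    qed
  qed
qed

text \<open>Points of the closure are limits of estimators and the distance to the Wigner spectrum
  is continuous, so a bound over all kernels extends to the closure.\<close>

lemma achieves_mmse_iff_locally_optimal:
  assumes \<phi>: "square_integrable half_plane \<phi>"
  shows "achieves_mmse M X t \<xi> (est \<phi>) \<longleftrightarrow> locally_optimal M X t \<xi> \<phi>"
proof -
  define W where "W = wigner_spectrum M X t \<xi>"
  have cl: "est \<psi> \<in> ms_closure M (estimator_space M X t \<xi>)" if "square_integrable half_plane \<psi>" for \<psi>
    using square_integrable_estimator[OF that] that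
    by (auto simp: ms_closure_def estimator_space_def ms_norm_def intro!: bexI[of _ "est \<psi>"])
  have W: "square_integrable M (\<lambda>_. W)"
    by (intro square_integrable_const prob_space_axioms)
  show ?thesis
  proof
    assume "achieves_mmse M X t \<xi> (est \<phi>)"
    then show "locally_optimal M X t \<xi> \<phi>"
      using \<phi> cl unfolding achieves_mmse_def locally_optimal_def kernel_error_def by blast
  next
    assume opt: "locally_optimal M X t \<xi> \<phi>"
    have "ms_error M W (est \<phi>) \<le> ms_error M W Z" if Z: "Z \<in> ms_closure M (estimator_space M X t \<xi>)" for Z
    proof -
      have Zs: "square_integrable M Z" using Z by (simp add: ms_closure_def)
      have "ms_norm M (\<lambda>\<omega>. est \<phi> \<omega> - W) \<le> ms_norm M (\<lambda>\<omega>. Z \<omega> - W)"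
      proof (rule field_le_epsilon)
        fix \<epsilon> :: real assume "0 < \<epsilon>"
        then obtain Y where "Y \<in> estimator_space M X t \<xi>" and lt: "ms_norm M (\<lambda>\<omega>. Z \<omega> - Y \<omega>) < \<epsilon>"
          using Z by (auto simp: ms_closure_def)
        then obtain \<psi> where \<psi>: "square_integrable half_plane \<psi>" and Y: "Y = est \<psi>"
          by (auto simp: estimator_space_def)
        have Ys: "square_integrable M Y" unfolding Y by (rule square_integrable_estimator[OF \<psi>])
        have "(ms_norm M (\<lambda>\<omega>. est \<phi> \<omega> - W))\<^sup>2 \<le> (ms_norm M (\<lambda>\<omega>. Y \<omega> - W))\<^sup>2"
          using opt \<psi> unfolding locally_optimal_def kernel_error_def ms_error_eq W_def Y by blast
        then have "ms_norm M (\<lambda>\<omega>. est \<phi> \<omega> - W) \<le> ms_norm M (\<lambda>\<omega>. Y \<omega> - W)"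
          by (rule power2_le_imp_le[OF _ ms_norm_nonneg])
        also have "\<dots> = ms_norm M (\<lambda>\<omega>. (Z \<omega> - W) + (Y \<omega> - Z \<omega>))" by simp
        also have "\<dots> \<le> ms_norm M (\<lambda>\<omega>. Z \<omega> - W) + ms_norm M (\<lambda>\<omega>. Y \<omega> - Z \<omega>)"
          by (rule ms_norm_triangle[OF square_integrable_diff[OF Zs W] square_integrable_diff[OF Ys Zs]])
        also have "ms_norm M (\<lambda>\<omega>. Y \<omega> - Z \<omega>) = ms_norm M (\<lambda>\<omega>. Z \<omega> - Y \<omega>)"
          by (simp add: ms_norm_def norm_minus_commute)
        finally show "ms_norm M (\<lambda>\<omega>. est \<phi> \<omega> - W) \<le> ms_norm M (\<lambda>\<omega>. Z \<omega> - W) + \<epsilon>"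
          using lt by linarith
      qed
      then show ?thesis
        unfolding ms_error_eq by (rule power_mono[OF _ ms_norm_nonneg])
    qed
    then show "achieves_mmse M X t \<xi> (est \<phi>)"
      using cl[OF \<phi>] unfolding achieves_mmse_def W_def by blast
  qed
qed

text \<open>Testing against \<open>cnj (sgn k) \<psi>0\<close> with a nowhere vanishing kernel \<open>\<psi>0\<close> turns the pairing
  into the integral of \<open>|k|\<close>, so the ambiguity function is orthogonal to \<open>e\<close> almost everywhere.\<close>

lemma orthogonal_to_estimators_iff:
  assumes e: "square_integrable M e"
  shows "(\<forall>\<psi>. square_integrable half_plane \<psi> \<longrightarrow> ms_inner M (est \<psi>) e = 0) \<longleftrightarrow>
    (\<forall>\<theta>. \<forall>\<tau>>0. ms_inner M (ambiguity M X \<theta> \<tau>) e = 0)"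
proof
  assume orth: "\<forall>\<psi>. square_integrable half_plane \<psi> \<longrightarrow> ms_inner M (est \<psi>) e = 0"
  obtain \<psi>0 where \<psi>0: "square_integrable half_plane \<psi>0" and nz: "\<And>z. z \<in> space half_plane \<Longrightarrow> \<psi>0 z \<noteq> 0"
    using positive_square_integrable_half_plane by blast
  note [measurable] = square_integrableD(1)[OF \<psi>0]
  define k where "k z = ms_inner M (ambiguity M X (fst z) (snd z)) e * \<psi>0 z * phase t \<xi> (fst z) (snd z)" for z
  have k: "integrable half_plane k"
    using ms_inner_estimator[OF \<psi>0 e] by (simp add: has_bochner_integral_iff k_def[abs_def])
  note [measurable] = borel_measurable_integrable[OF k]
  define \<psi> where "\<psi> z = cnj (sgn (k z)) * \<psi>0 z" for z
  have \<psi>: "square_integrable half_plane \<psi>"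
  proof (rule square_integrable_mult_bounded[OF \<psi>0])
    show "\<psi> \<in> borel_measurable half_plane"
      unfolding \<psi>_def[abs_def] sgn_div_norm by measurable
    show "cmod (\<psi> z) \<le> cmod (\<psi>0 z)" for z
      by (simp add: \<psi>_def norm_mult norm_sgn)
  qed
  have "ms_inner M (ambiguity M X (fst z) (snd z)) e * \<psi> z * phase t \<xi> (fst z) (snd z) = of_real (cmod (k z))" for z
  proof -
    have "ms_inner M (ambiguity M X (fst z) (snd z)) e * \<psi> z * phase t \<xi> (fst z) (snd z) = k z * cnj (sgn (k z))"
      by (simp add: k_def \<psi>_def mult_ac)
    \<comment> \<open>At zeros of \<open>k\<close> both sides are 0, since \<open>sgn 0 = 0\<close>
      and division by 0 gives 0.\<close>
    also have "\<dots> = of_real ((cmod (k z))\<^sup>2) / of_real (cmod (k z))"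
      unfolding complex_norm_square by (simp add: sgn_div_norm scaleR_conv_of_real divide_inverse mult_ac)
    also have "\<dots> = of_real (cmod (k z))" by (simp add: power2_eq_square)
    finally show ?thesis .
  qed
  then have "(\<integral>z. complex_of_real (cmod (k z)) \<partial>half_plane) = 0"
    using ms_inner_estimator[OF \<psi> e] orth \<psi> by (simp add: has_bochner_integral_iff)
  then have "(\<integral>z. cmod (k z) \<partial>half_plane) = 0" by simp
  then have "AE z in half_plane. k z = 0"
    using integral_nonneg_eq_0_iff_AE[OF integrable_norm[OF k]] by simp
  then have ae: "AE z in half_plane. ms_inner M (ambiguity M X (fst z) (snd z)) e = 0"
    using AE_space
  \<comment> \<open>Neither \<open>\<psi>0\<close> nor the phase vanishes on the half plane, so both
    factors can be cancelled from \<open>k z = 0\<close>.\<close>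
  proof eventually_elim
    case (elim z)
    then have "phase t \<xi> (fst z) (snd z) \<noteq> 0"
      by (intro phase_nonzero t) auto
    then show ?case using elim nz by (simp add: k_def)
  qed
  show "\<forall>\<theta>. \<forall>\<tau>>0. ms_inner M (ambiguity M X \<theta> \<tau>) e = 0"
    using ambiguity_orthogonal_everywhere[OF e ae] by simp
next
  assume orth: "\<forall>\<theta>. \<forall>\<tau>>0. ms_inner M (ambiguity M X \<theta> \<tau>) e = 0"
  show "\<forall>\<psi>. square_integrable half_plane \<psi> \<longrightarrow> ms_inner M (est \<psi>) e = 0"
  proof (intro allI impI)
    fix \<psi> assume \<psi>: "square_integrable half_plane \<psi>"
    have "(\<integral>z. ms_inner M (ambiguity M X (fst z) (snd z)) e * \<psi> z * phase t \<xi> (fst z) (snd z) \<partial>half_plane)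
        = (\<integral>z. 0 \<partial>half_plane)"
      using orth by (intro Bochner_Integration.integral_cong) auto
    then show "ms_inner M (est \<psi>) e = 0"
      using has_bochner_integral_integral_eq[OF ms_inner_estimator[OF \<psi> e]] by simp
  qed
qed

end

end

theorem mainTheorem4:
  fixes M :: "'a measure" and X :: "real \<Rightarrow> 'a \<Rightarrow> complex"
  assumes "prob_space M"
    and "gaussian_process M X" and "zero_mean M X" and "measurable_process M X"
    and "real_valued M X \<or> circularly_symmetric M X"
    and "\<And>\<theta> \<tau>. \<tau> > 0 \<Longrightarrow> ms_integrable M (lebesgue_on {0<..}) (ambiguity_integrand X \<theta> \<tau>)"
    and "\<And>t \<xi>. t > 0 \<Longrightarrow> integrable (lebesgue_on {0<..}) (wigner_integrand M X t \<xi>)"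
    and "\<And>\<phi> t \<xi>. square_integrable half_plane \<phi> \<Longrightarrow> t > 0 \<Longrightarrow>
           ms_integrable M half_plane (estimator_integrand M X \<phi> t \<xi>)"
  shows "\<forall>t>0. \<forall>\<xi>. \<forall>\<phi>. square_integrable half_plane \<phi> \<longrightarrow>
     (let P = estimator M X \<phi> t \<xi>; W = wigner_spectrum M X t \<xi>; A = ambiguity M X;
          orthogonal_error = (\<forall>\<theta>'. \<forall>\<tau>'>0. (\<integral>\<omega>. (P \<omega> - W) * cnj (A \<theta>' \<tau>' \<omega>) \<partial>M) = 0);
          linear_equation = (\<forall>\<theta>'. \<forall>\<tau>'>0.
            (\<integral>(\<theta>, \<tau>). (\<integral>\<omega>. A \<theta> \<tau> \<omega> * cnj (A \<theta>' \<tau>' \<omega>) \<partial>M) * \<phi> (\<theta>, \<tau>) * phase t \<xi> \<theta> \<tau> \<partial>half_plane)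
              = W * (\<integral>\<omega>. cnj (A \<theta>' \<tau>' \<omega>) \<partial>M))
      in (achieves_mmse M X t \<xi> P \<longleftrightarrow> orthogonal_error) \<and>
         (orthogonal_error \<longleftrightarrow> linear_equation) \<and>
         (locally_optimal M X t \<xi> \<phi> \<longleftrightarrow> linear_equation))"
proof (intro allI impI)
  interpret prob_space M by fact
  interpret estimator_process M X
    by unfold_locales (fact assms)+
  fix t \<xi> :: real and \<phi> :: "real \<times> real \<Rightarrow> complex"
  assume t: "0 < t" and \<phi>: "square_integrable half_plane \<phi>"
  define P where "P = estimator M X \<phi> t \<xi>"
  define W where "W = wigner_spectrum M X t \<xi>"
  define A where "A = ambiguity M X"
  define orthogonal_error where "orthogonal_error = (\<forall>\<theta>'. \<forall>\<tau>'>0. (\<integral>\<omega>. (P \<omega> - W) * cnj (A \<theta>' \<tau>' \<omega>) \<partial>M) = 0)"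
  define linear_equation where "linear_equation = (\<forall>\<theta>'. \<forall>\<tau>'>0.
            (\<integral>(\<theta>, \<tau>). (\<integral>\<omega>. A \<theta> \<tau> \<omega> * cnj (A \<theta>' \<tau>' \<omega>) \<partial>M) * \<phi> (\<theta>, \<tau>) * phase t \<xi> \<theta> \<tau> \<partial>half_plane)
              = W * (\<integral>\<omega>. cnj (A \<theta>' \<tau>' \<omega>) \<partial>M))"
  have P: "square_integrable M P"
    unfolding P_def by (rule square_integrable_estimator[OF t \<phi>])
  have W: "square_integrable M (\<lambda>_. W)"
    by (rule square_integrable_const[OF prob_space_axioms])
  have e: "square_integrable M (\<lambda>\<omega>. P \<omega> - W)"
    by (rule square_integrable_diff[OF P W])
  \<comment> \<open>The orthogonality lemmas have the error in the conjugated slot; exchanging the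
    slots conjugates the value and preserves its vanishing.\<close>
  have "(\<integral>\<omega>. (P \<omega> - W) * cnj (A \<theta>' \<tau>' \<omega>) \<partial>M) = cnj (ms_inner M (A \<theta>' \<tau>') (\<lambda>\<omega>. P \<omega> - W))" for \<theta>' \<tau>'
    unfolding ms_inner_commute[symmetric] by (simp only: ms_inner_def)
  then have "orthogonal_error \<longleftrightarrow> (\<forall>\<theta>. \<forall>\<tau>>0. ms_inner M (A \<theta> \<tau>) (\<lambda>\<omega>. P \<omega> - W) = 0)"
    by (simp add: orthogonal_error_def)
  also have "\<dots> \<longleftrightarrow> locally_optimal M X t \<xi> \<phi>"
    using orthogonal_to_estimators_iff[OF t e, of \<xi>] locally_optimal_iff[OF t \<phi>, of \<xi>]
    unfolding P_def[symmetric] W_def[symmetric] A_def[symmetric] by simp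
  finally have opt: "orthogonal_error \<longleftrightarrow> locally_optimal M X t \<xi> \<phi>" .
  have "(\<integral>\<omega>. (P \<omega> - W) * cnj (A \<theta>' \<tau>' \<omega>) \<partial>M) =
      (\<integral>(\<theta>, \<tau>). (\<integral>\<omega>. A \<theta> \<tau> \<omega> * cnj (A \<theta>' \<tau>' \<omega>) \<partial>M) * \<phi> (\<theta>, \<tau>) * phase t \<xi> \<theta> \<tau> \<partial>half_plane)
        - W * (\<integral>\<omega>. cnj (A \<theta>' \<tau>' \<omega>) \<partial>M)" if "0 < \<tau>'" for \<theta>' \<tau>'
  proof -
    have A': "square_integrable M (A \<theta>' \<tau>')"
      unfolding A_def by (rule square_integrable_ambiguity[OF that])
    have "(\<integral>\<omega>. (P \<omega> - W) * cnj (A \<theta>' \<tau>' \<omega>) \<partial>M) = ms_inner M P (A \<theta>' \<tau>') - ms_inner M (\<lambda>_. W) (A \<theta>' \<tau>')"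
      using ms_inner_diff_left[OF P W A'] by (simp only: ms_inner_def)
    \<comment> \<open>The weak form of the integral defining \<open>P\<close>, now tested against
      \<open>A \<theta>' \<tau>'\<close> instead of the error.\<close>
    moreover have "ms_inner M P (A \<theta>' \<tau>') =
      (\<integral>(\<theta>, \<tau>). (\<integral>\<omega>. A \<theta> \<tau> \<omega> * cnj (A \<theta>' \<tau>' \<omega>) \<partial>M) * \<phi> (\<theta>, \<tau>) * phase t \<xi> \<theta> \<tau> \<partial>half_plane)"
      using has_bochner_integral_integral_eq[OF ms_inner_estimator[OF t \<phi> A', of \<xi>]]
      by (simp only: P_def A_def ms_inner_def case_prod_unfold prod.collapse)
    ultimately show ?thesis
      by (simp add: ms_inner_def)
  qed
  then have "orthogonal_error \<longleftrightarrow> linear_equation"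
    by (simp add: orthogonal_error_def linear_equation_def)
  then show "let P = estimator M X \<phi> t \<xi>; W = wigner_spectrum M X t \<xi>; A = ambiguity M X;
          orthogonal_error = (\<forall>\<theta>'. \<forall>\<tau>'>0. (\<integral>\<omega>. (P \<omega> - W) * cnj (A \<theta>' \<tau>' \<omega>) \<partial>M) = 0);
          linear_equation = (\<forall>\<theta>'. \<forall>\<tau>'>0.
            (\<integral>(\<theta>, \<tau>). (\<integral>\<omega>. A \<theta> \<tau> \<omega> * cnj (A \<theta>' \<tau>' \<omega>) \<partial>M) * \<phi> (\<theta>, \<tau>) * phase t \<xi> \<theta> \<tau> \<partial>half_plane)
              = W * (\<integral>\<omega>. cnj (A \<theta>' \<tau>' \<omega>) \<partial>M))
      in (achieves_mmse M X t \<xi> P \<longleftrightarrow> orthogonal_error) \<and>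
         (orthogonal_error \<longleftrightarrow> linear_equation) \<and>
         (locally_optimal M X t \<xi> \<phi> \<longleftrightarrow> linear_equation)"
    using opt achieves_mmse_iff_locally_optimal[OF t \<phi>, of \<xi>]
    unfolding Let_def P_def[symmetric] W_def[symmetric] A_def[symmetric]
      orthogonal_error_def[symmetric] linear_equation_def[symmetric]
    by simp
qed

end
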